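(* The (linear) Spencer sequence $\hat C_0\xrightarrow{D_1}\hat C_1\xrightarrow{D_2}\hat C_2\xrightarrow{D_3}\cdots$ for the conformal Lie pseudogroup projects onto the Poincaré sequence with a shift by one step, i.e. onto $T^*\xrightarrow{d}\wedge^2T^*\xrightarrow{d}\wedge^3T^*\to\cdots$.
   Context: $X$ is a manifold of dimension $n$ with tangent and cotangent bundles $T$, $T^*$; $\wedge^rT^*$ is the bundle of $r$-forms, $S_qT^*$ the bundle of $q$-symmetric tensors, and $J_q(T)$ the $q$-jet bundle of $T$, whose sections $\xi_q$ have components $\xi^k_\mu$, $0\le|\mu|\le q$ (written $\xi^k,\xi^k_i,\xi^k_{ij},\dots$). The same notation is used for a bundle and for its sections. The Poincaré sequence is $\wedge^0T^*\xrightarrow{d}\wedge^1T^*\xrightarrow{d}\wedge^2T^*\xrightarrow{d}\cdots\xrightarrow{d}\wedge^nT^*\to0$, with $d$ the exterior derivative. "With a shift by one step" means that the place of degree $r$ in the Spencer sequence corresponds to the place of degree $r+1$ in the Poincaré sequence. Conformal Lie pseudogroup: the conformal group of transformations of space-time, with 15 parameters, considered as a Lie pseudogroup, i.e. as the solutions of a system of partial differential equations. Let $\omega=(\omega_{ij})\in S_2T^*$ with $\det(\omega)\neq0$ be the underlying metric, $(\omega^{ij})$ its inverse and $\gamma=(\gamma^k_{ij})$ its Christoffel symbols. Its infinitesimal equations form the conformal Killing system $\hat R_2\subset J_2(T)$, consisting of the $\xi_2$ for which there are a function $A(x)$ and a 1-form $A_i(x)dx^i$, both arbitrary, with $$\omega_{rj}\xi^r_i+\omega_{ir}\xi^r_j+\xi^r\partial_r\omega_{ij}=A\,\omega_{ij},$$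 $$\xi^k_{ij}+\gamma^k_{rj}\xi^r_i+\gamma^k_{ir}\xi^r_j-\gamma^r_{ij}\xi^k_r+\xi^r\partial_r\gamma^k_{ij}=\delta^k_iA_j+\delta^k_jA_i-\omega_{ij}\omega^{kr}A_r .$$ Spencer sequence: the Spencer operator $D:J_{q+1}(T)\to T^*\otimes J_q(T)$ has components $(D\xi_{q+1})^k_{\mu,i}=\partial_i\xi^k_\mu-\xi^k_{\mu+1_i}$ and is extended to $D:\wedge^rT^*\otimes J_{q+1}(T)\to\wedge^{r+1}T^*\otimes J_q(T)$ by $\alpha\otimes\xi_{q+1}\mapsto d\alpha\otimes\xi_q+(-1)^r\alpha\wedge D\xi_{q+1}$. The Spencer map $\delta:\wedge^sT^*\otimes S_{q+1}T^*\otimes T\to\wedge^{s+1}T^*\otimes S_qT^*\otimes T$ is $(\delta\omega)^k_\mu=dx^i\wedge\omega^k_{\mu+1_i}$. The Spencer bundles are $\hat C_r=\wedge^rT^*\otimes\hat R_2/\delta(\wedge^{r-1}T^*\otimes\hat g_3)$, where $\hat g_3\subset S_3T^*\otimes T$ is the symbol of the first prolongation of $\hat R_2$ (the system obtained by differentiating its equations once); here $\hat C_r=\wedge^rT^*\otimes\hat R_2$. The first order operators $D_{r+1}:\hat C_r\to\hat C_{r+1}$ are those induced by the extended operator $D$. *)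

theory Defs
  imports "HOL-Analysis.Analysis"
begin

subsection \<open>Partial derivatives and smooth functions of n real variables\<close>

definition pd :: "'n::finite \<Rightarrow> (real^'n \<Rightarrow> real) \<Rightarrow> real^'n \<Rightarrow> real" where
  "pd i f x = frechet_derivative f (at x) (axis i 1)"

fun pds :: "'n::finite list \<Rightarrow> (real^'n \<Rightarrow> real) \<Rightarrow> real^'n \<Rightarrow> real" where
  "pds [] f = f"
| "pds (i # is) f = pd i (pds is f)"

text \<open>For an open set \<open>S\<close> this is the class of C-infinity functions on \<open>S\<close>.\<close>

definition smooth_on :: "(real^'n::finite) set \<Rightarrow> (real^'n \<Rightarrow> real) \<Rightarrow> bool" where
  "smooth_on S f \<longleftrightarrow> (\<forall>is. \<forall>x\<in>S. pds is f differentiable (at x))"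

definition smooth_map_on :: "(real^'n::finite) set \<Rightarrow> (real^'n \<Rightarrow> real^'m) \<Rightarrow> bool" where
  "smooth_map_on S f \<longleftrightarrow> (\<forall>k. smooth_on S (\<lambda>x. f x $ k))"

definition jac :: "(real^'n::finite \<Rightarrow> real^'n) \<Rightarrow> real^'n \<Rightarrow> real^'n^'n" where
  "jac T x = matrix (frechet_derivative T (at x))"


subsection \<open>Smooth manifolds of dimension \<open>CARD('n)\<close>\<close>

text \<open>A chart is a domain together with a coordinate map. The manifold is the whole type
  \<open>'a\<close>. A tensor field, form or jet field is given by its components in every chart, as functions
  of the coordinates of that chart; the components in two charts are related on the overlap by
  the transition law of the bundle.\<close>

type_synonym ('a, 'n) chart = "'a set \<times> ('a \<Rightarrow> real^'n)"

definition img :: "('a, 'n::finite) chart \<Rightarrow> (real^'n) set" where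
  "img c = snd c ` fst c"

definition overlap :: "('a, 'n::finite) chart \<Rightarrow> ('a, 'n) chart \<Rightarrow> (real^'n) set" where
  "overlap c c' = snd c ` (fst c \<inter> fst c')"

definition trans_map :: "('a, 'n::finite) chart \<Rightarrow> ('a, 'n) chart \<Rightarrow> real^'n \<Rightarrow> real^'n" where
  "trans_map c c' = snd c' \<circ> the_inv_into (fst c) (snd c)"

definition smooth_atlas ::
    "('a::{t2_space, second_countable_topology}, 'n::finite) chart set \<Rightarrow> bool" where
  "smooth_atlas \<A> \<longleftrightarrow>
     (\<Union>c\<in>\<A>. fst c) = UNIV \<and>
     (\<forall>c\<in>\<A>. open (fst c) \<and> open (img c) \<and>
        homeomorphism (fst c) (img c) (snd c) (the_inv_into (fst c) (snd c))) \<and>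
     (\<forall>c\<in>\<A>. \<forall>c'\<in>\<A>. smooth_map_on (overlap c c') (trans_map c c'))"


subsection \<open>Exterior forms\<close>

text \<open>An \<open>r\<close>-form at a point is given by its components \<open>\<alpha>\<^sub>I\<close>, skew-symmetric in the
  multi-index \<open>I\<close> of length \<open>r\<close>; the components at lists of any other length are set to zero.
  The form is the sum of \<open>\<alpha>\<^sub>I dx\<^sup>I\<close> over strictly increasing \<open>I\<close>.\<close>

definition form_fibre :: "nat \<Rightarrow> ('n::finite list \<Rightarrow> real) set" where
  "form_fibre r = {\<alpha>. (\<forall>I. length I \<noteq> r \<longrightarrow> \<alpha> I = 0) \<and>
     (\<forall>I p q. p < q \<and> q < length I \<longrightarrow> \<alpha> (I[p := I ! q, q := I ! p]) = - \<alpha> I)}"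

text \<open>Components of a pull-back along a map with Jacobian matrix \<open>J\<close>.\<close>

definition pull_form :: "real^'n^'n \<Rightarrow> ('n::finite list \<Rightarrow> real) \<Rightarrow> 'n list \<Rightarrow> real" where
  "pull_form J \<alpha> I =
     (\<Sum>I' | length I' = length I. (\<Prod>s<length I. J $ (I' ! s) $ (I ! s)) * \<alpha> I')"

definition del_nth :: "nat \<Rightarrow> 'b list \<Rightarrow> 'b list" where
  "del_nth s I = take s I @ drop (Suc s) I"

definition ext_d :: "(real^'n \<Rightarrow> 'n::finite list \<Rightarrow> real) \<Rightarrow> real^'n \<Rightarrow> 'n list \<Rightarrow> real" where
  "ext_d \<alpha> x I = (\<Sum>s<length I. (-1) ^ s * pd (I ! s) (\<lambda>y. \<alpha> y (del_nth s I)) x)"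


subsection \<open>Jets of vector fields\<close>

text \<open>The components \<open>\<xi>\<^sup>k\<^sub>\<mu>\<close> of a \<open>q\<close>-jet, the multi-index \<open>\<mu>\<close> being a multiset of
  indices with \<open>size \<mu> \<le> q\<close>, so that \<open>\<mu> + 1\<^sub>i\<close> is \<open>add_mset i \<mu>\<close>. The components of higher order
  are set to zero.\<close>

type_synonym 'n jet = "'n \<Rightarrow> 'n multiset \<Rightarrow> real"

definition jets :: "nat \<Rightarrow> 'n jet set" where
  "jets q = {\<xi>. \<forall>k \<mu>. q < size \<mu> \<longrightarrow> \<xi> k \<mu> = 0}"

definition is_jet :: "nat \<Rightarrow> (real^'n \<Rightarrow> real^'n) \<Rightarrow> real^'n \<Rightarrow> 'n::finite jet \<Rightarrow> bool" where
  "is_jet q v x \<xi> \<longleftrightarrow> \<xi> \<in> jets q \<and>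
     (\<forall>k is. length is \<le> q \<longrightarrow> \<xi> k (mset is) = pds is (\<lambda>y. v y $ k) x)"

text \<open>Transition law of the \<open>q\<close>-jet bundle of the tangent bundle: \<open>\<xi>\<close> at \<open>x\<close> and \<open>\<xi>'\<close> at \<open>T x\<close>
  represent the same jet if they are the jets of one vector field, expressed in the
  two coordinate systems.\<close>

definition same_jet :: "nat \<Rightarrow> (real^'n::finite) set \<Rightarrow> (real^'n \<Rightarrow> real^'n) \<Rightarrow> real^'n \<Rightarrow>
    'n jet \<Rightarrow> 'n jet \<Rightarrow> bool" where
  "same_jet q S T x \<xi> \<xi>' \<longleftrightarrow>
     (\<exists>N v w. open N \<and> x \<in> N \<and> N \<subseteq> S \<and> smooth_map_on N v \<and> smooth_map_on (T ` N) w \<and>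
        (\<forall>y\<in>N. w (T y) = jac T y *v v y) \<and> is_jet q v x \<xi> \<and> is_jet q w (T x) \<xi>')"

text \<open>Jet-valued forms: \<open>Z I k \<mu>\<close> is the component of index \<open>I\<close> of the form
  with values in the jets.\<close>

type_synonym 'n jform = "'n list \<Rightarrow> 'n jet"

definition same_jform :: "nat \<Rightarrow> (real^'n::finite) set \<Rightarrow> (real^'n \<Rightarrow> real^'n) \<Rightarrow> real^'n \<Rightarrow>
    'n jform \<Rightarrow> 'n jform \<Rightarrow> bool" where
  "same_jform q S T x Z Z' \<longleftrightarrow>
     (\<forall>I. same_jet q S T x (Z I) (\<lambda>k \<mu>. pull_form (jac T x) (\<lambda>I'. Z' I' k \<mu>) I))"


subsection \<open>The metric and the conformal Killing system\<close>

definition metric_tensor ::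
    "('a, 'n::finite) chart set \<Rightarrow> (('a, 'n) chart \<Rightarrow> real^'n \<Rightarrow> real^'n^'n) \<Rightarrow> bool" where
  "metric_tensor \<A> \<omega> \<longleftrightarrow>
     (\<forall>c\<in>\<A>. (\<forall>x\<in>img c. transpose (\<omega> c x) = \<omega> c x \<and> det (\<omega> c x) \<noteq> 0) \<and>
        (\<forall>i j. smooth_on (img c) (\<lambda>x. \<omega> c x $ i $ j))) \<and>
     (\<forall>c\<in>\<A>. \<forall>c'\<in>\<A>. \<forall>x\<in>overlap c c'.
        \<omega> c x = transpose (jac (trans_map c c') x) ** \<omega> c' (trans_map c c' x)
                  ** jac (trans_map c c') x)"

text \<open>From here on, \<open>g\<close> is the coordinate expression of the metric in one chart;
  \<open>christoffel g k i j\<close> has the upper index \<open>k\<close>.\<close>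

definition christoffel ::
    "(real^'n \<Rightarrow> real^'n^'n) \<Rightarrow> 'n::finite \<Rightarrow> 'n \<Rightarrow> 'n \<Rightarrow> real^'n \<Rightarrow> real" where
  "christoffel g k i j x = (1/2) * (\<Sum>r\<in>UNIV. matrix_inv (g x) $ k $ r *
     (pd i (\<lambda>y. g y $ r $ j) x + pd j (\<lambda>y. g y $ r $ i) x - pd r (\<lambda>y. g y $ i $ j) x))"

definition killing_eq1 :: "(real^'n \<Rightarrow> real^'n^'n) \<Rightarrow> real^'n \<Rightarrow> 'n::finite jet \<Rightarrow> real \<Rightarrow>
    'n \<Rightarrow> 'n \<Rightarrow> real" where
  "killing_eq1 g x \<xi> A i j =
     (\<Sum>r\<in>UNIV. g x $ r $ j * \<xi> r {#i#} + g x $ i $ r * \<xi> r {#j#}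
        + \<xi> r {#} * pd r (\<lambda>y. g y $ i $ j) x)
     - A * g x $ i $ j"

definition killing_eq2 :: "(real^'n \<Rightarrow> real^'n^'n) \<Rightarrow> real^'n \<Rightarrow> 'n::finite jet \<Rightarrow> real^'n \<Rightarrow>
    'n \<Rightarrow> 'n \<Rightarrow> 'n \<Rightarrow> real" where
  "killing_eq2 g x \<xi> a k i j =
     \<xi> k {#i, j#}
     + (\<Sum>r\<in>UNIV. christoffel g k r j x * \<xi> r {#i#} + christoffel g k i r x * \<xi> r {#j#}
          - christoffel g r i j x * \<xi> k {#r#} + \<xi> r {#} * pd r (christoffel g k i j) x)
     - (of_bool (k = i) * a $ j + of_bool (k = j) * a $ i
          - g x $ i $ j * (\<Sum>r\<in>UNIV. matrix_inv (g x) $ k $ r * a $ r))"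

definition conf2 :: "(real^'n \<Rightarrow> real^'n^'n) \<Rightarrow> real^'n \<Rightarrow> 'n::finite jet set" where
  "conf2 g x = {\<xi> \<in> jets 2. \<exists>A a. \<forall>i j. killing_eq1 g x \<xi> A i j = 0 \<and>
     (\<forall>k. killing_eq2 g x \<xi> a k i j = 0)}"

text \<open>The first prolongation of the conformal Killing system. The formal derivative of an
  equation in the direction \<open>l\<close> is its ordinary derivative along the line
  \<open>x + t e\<^sub>l\<close>, \<open>\<xi>\<^sub>\<mu> + t \<xi>\<^bsub>\<mu>+1\<^sub>l\<^esub>\<close>, \<open>A + t A\<^bsub>,l\<^esub>\<close>, \<open>A\<^sub>i + t A\<^bsub>i,l\<^esub>\<close> at \<open>t = 0\<close>.\<close>

definition conf3 :: "(real^'n \<Rightarrow> real^'n^'n) \<Rightarrow> real^'n \<Rightarrow> 'n::finite jet set" where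
  "conf3 g x = {\<xi> \<in> jets 3. \<exists>A a A' a'. \<forall>i j.
     killing_eq1 g x \<xi> A i j = 0 \<and> (\<forall>k. killing_eq2 g x \<xi> a k i j = 0) \<and>
     (\<forall>l. ((\<lambda>t. killing_eq1 g (x + t *\<^sub>R axis l 1) (\<lambda>k \<mu>. \<xi> k \<mu> + t * \<xi> k (add_mset l \<mu>))
              (A + t * A' l) i j) has_real_derivative 0) (at 0)) \<and>
     (\<forall>k l. ((\<lambda>t. killing_eq2 g (x + t *\<^sub>R axis l 1) (\<lambda>k \<mu>. \<xi> k \<mu> + t * \<xi> k (add_mset l \<mu>))
              (a + t *\<^sub>R a' l) k i j) has_real_derivative 0) (at 0))}"

text \<open>The conformal transformations form a Lie pseudogroup with the full number
  of \<open>dim conf2 = (n + 1) * (n + 2) / 2\<close> parameters (15 in space-time, \<open>n = 4\<close>):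
  every element of the system at a point is the 2-jet of a local solution. Such a
  solution is determined near the point by its 2-jet if \<open>n \<ge> 3\<close>.\<close>

definition conformal_pseudogroup ::
    "('a, 'n::finite) chart set \<Rightarrow> (('a, 'n) chart \<Rightarrow> real^'n \<Rightarrow> real^'n^'n) \<Rightarrow> bool" where
  "conformal_pseudogroup \<A> \<omega> \<longleftrightarrow>
     (\<forall>c\<in>\<A>. \<forall>x\<in>img c. \<forall>\<xi>\<in>conf2 (\<omega> c) x. \<exists>N v.
        open N \<and> x \<in> N \<and> N \<subseteq> img c \<and> smooth_map_on N v \<and> is_jet 2 v x \<xi> \<and>
        (\<forall>y\<in>N. \<exists>\<eta>\<in>conf2 (\<omega> c) y. is_jet 2 v y \<eta>))"


subsection \<open>The Spencer sequence\<close>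

text \<open>The extended Spencer operator on \<open>r\<close>-forms with values in the jets of order \<open>q + 1\<close>.
  Since \<open>(-1)\<^sup>r \<alpha> \<and> dx\<^sup>i = dx\<^sup>i \<and> \<alpha>\<close>, the form
  \<open>d\<alpha> \<otimes> \<xi>\<^sub>q + (-1)\<^sup>r \<alpha> \<and> D\<xi>\<^bsub>q+1\<^esub>\<close> has the components
  \<open>dx\<^sup>i \<and> (\<partial>\<^sub>i Z\<^sup>k\<^sub>\<mu> - Z\<^sup>k\<^bsub>\<mu>+1\<^sub>i\<^esub>)\<close> for \<open>Z = \<alpha> \<otimes> \<xi>\<^bsub>q+1\<^esub>\<close>.\<close>

definition spencer_ext ::
    "nat \<Rightarrow> (real^'n \<Rightarrow> 'n::finite jform) \<Rightarrow> real^'n \<Rightarrow> 'n jform" where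
  "spencer_ext q Z x I k \<mu> = (if size \<mu> \<le> q then
     (\<Sum>s<length I. (-1) ^ s * (pd (I ! s) (\<lambda>y. Z y (del_nth s I) k \<mu>) x
        - Z x (del_nth s I) k (add_mset (I ! s) \<mu>))) else 0)"

text \<open>The fibre of \<open>\<And>\<^sup>r T\<^sup>* \<otimes> R\<^sub>2\<close>, where \<open>R\<^sub>2\<close> is the conformal Killing system. For \<open>n \<ge> 3\<close>
  the symbol of its prolongation vanishes, so this is the fibre of the Spencer bundle.\<close>

definition spencer_fibre ::
    "(real^'n \<Rightarrow> real^'n^'n) \<Rightarrow> nat \<Rightarrow> real^'n \<Rightarrow> 'n::finite jform set" where
  "spencer_fibre g r x = {Z. (\<forall>k \<mu>. (\<lambda>I. Z I k \<mu>) \<in> form_fibre r) \<and> (\<forall>I. Z I \<in> conf2 g x)}"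

text \<open>The element of the prolongation lying over \<open>\<xi>\<close>, which is unique for \<open>n \<ge> 3\<close> because the
  symbol of the prolongation vanishes.\<close>

definition lift3 :: "(real^'n \<Rightarrow> real^'n^'n) \<Rightarrow> real^'n \<Rightarrow> 'n::finite jet \<Rightarrow> 'n jet" where
  "lift3 g x \<xi> = (SOME \<zeta>. \<zeta> \<in> conf3 g x \<and> (\<forall>k \<mu>. size \<mu> \<le> 2 \<longrightarrow> \<zeta> k \<mu> = \<xi> k \<mu>))"

definition spencer_D :: "(real^'n \<Rightarrow> real^'n^'n) \<Rightarrow> (real^'n \<Rightarrow> 'n::finite jform) \<Rightarrow>
    real^'n \<Rightarrow> 'n jform" where
  "spencer_D g X = spencer_ext 2 (\<lambda>x I. lift3 g x (X x I))"

definition smooth_spencer_in_chart :: "(('a, 'n::finite) chart \<Rightarrow> real^'n \<Rightarrow> real^'n^'n) \<Rightarrow> nat \<Rightarrow>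
    ('a, 'n) chart \<Rightarrow> (real^'n \<Rightarrow> 'n jform) \<Rightarrow> bool" where
  "smooth_spencer_in_chart \<omega> r c X \<longleftrightarrow>
     (\<forall>x\<in>img c. X x \<in> spencer_fibre (\<omega> c) r x) \<and>
     (\<forall>I k \<mu>. smooth_on (img c) (\<lambda>x. X x I k \<mu>))"

definition spencer_sections ::
    "('a, 'n::finite) chart set \<Rightarrow> (('a, 'n) chart \<Rightarrow> real^'n \<Rightarrow> real^'n^'n) \<Rightarrow> nat \<Rightarrow>
      (('a, 'n) chart \<Rightarrow> real^'n \<Rightarrow> 'n jform) set" where
  "spencer_sections \<A> \<omega> r = {X.
     (\<forall>c\<in>\<A>. smooth_spencer_in_chart \<omega> r c (X c)) \<and>
     (\<forall>c\<in>\<A>. \<forall>c'\<in>\<A>. \<forall>x\<in>overlap c c'.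
        same_jform 2 (overlap c c') (trans_map c c') x (X c x) (X c' (trans_map c c' x)))}"

text \<open>Smooth vector bundle epimorphisms from the Spencer bundle of degree \<open>r\<close> onto the bundle of
  \<open>m\<close>-forms, given by their fibre maps in every chart: linear and surjective on the
  fibres, compatible with the transition laws, and smooth.\<close>

definition bundle_epi ::
    "('a, 'n::finite) chart set \<Rightarrow> (('a, 'n) chart \<Rightarrow> real^'n \<Rightarrow> real^'n^'n) \<Rightarrow> nat \<Rightarrow> nat \<Rightarrow>
      (('a, 'n) chart \<Rightarrow> real^'n \<Rightarrow> 'n jform \<Rightarrow> 'n list \<Rightarrow> real) \<Rightarrow> bool" where
  "bundle_epi \<A> \<omega> r m \<Phi> \<longleftrightarrow>
     (\<forall>c\<in>\<A>. \<forall>x\<in>img c.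
        (\<forall>Z\<in>spencer_fibre (\<omega> c) r x. \<forall>W\<in>spencer_fibre (\<omega> c) r x. \<forall>a b. \<forall>J.
           \<Phi> c x (\<lambda>I k \<mu>. a * Z I k \<mu> + b * W I k \<mu>) J = a * \<Phi> c x Z J + b * \<Phi> c x W J) \<and>
        \<Phi> c x ` spencer_fibre (\<omega> c) r x = form_fibre m) \<and>
     (\<forall>c\<in>\<A>. \<forall>c'\<in>\<A>. \<forall>x\<in>overlap c c'.
        \<forall>Z\<in>spencer_fibre (\<omega> c) r x. \<forall>Z'\<in>spencer_fibre (\<omega> c') r (trans_map c c' x).
          same_jform 2 (overlap c c') (trans_map c c') x Z Z' \<longrightarrow>
          \<Phi> c x Z = pull_form (jac (trans_map c c') x) (\<Phi> c' (trans_map c c' x) Z')) \<and>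
     (\<forall>c\<in>\<A>. \<forall>X. smooth_spencer_in_chart \<omega> r c X \<longrightarrow>
        (\<forall>J. smooth_on (img c) (\<lambda>x. \<Phi> c x (X x) J)))"

end

theory Submission
  imports Defs
begin

text \<open>On 2-jets of vector fields consider the formal derivative of the divergence,
  \<open>\<theta>\<^sub>i(\<xi>) = \<xi>\<^sup>r\<^sub>r\<^sub>i + \<gamma>\<^sub>r \<xi>\<^sup>r\<^sub>i + \<xi>\<^sup>r \<partial>\<^sub>r \<gamma>\<^sub>i\<close> with \<open>\<gamma>\<^sub>i\<close> the logarithmic derivative of the
  density of the metric. It is a covector because the divergence is a scalar, and on the conformal
  Killing system it equals \<open>n A\<^sub>i\<close>, hence it is onto there. The projection in degree \<open>r\<close> is
  \<open>\<alpha> \<otimes> \<xi> \<mapsto> \<alpha> \<and> \<theta>(\<xi>)\<close>. It intertwines \<open>D\<close> and \<open>d\<close> because the difference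
  \<open>\<partial>\<^sub>j(\<theta>\<^sub>i(\<xi>)) - \<theta>\<^sub>i(D\<^sub>j \<xi>)\<close> is a formal second derivative of the divergence; it is therefore symmetric
  in \<open>i\<close> and \<open>j\<close> and drops out after skew-symmetrization, whatever the third order components of
  the lift are. That a lift to the first prolongation exists at all follows from the local
  solutions: it is the 3-jet of a solution.\<close>

subsection \<open>Partial derivatives and smooth functions\<close>

text \<open>The covector arises by contracting \<open>k\<close> with \<open>i\<close> in the second
  Killing equation: the terms \<open>\<gamma>\<^sup>k\<^sub>r\<^sub>j \<xi>\<^sup>r\<^sub>k\<close>
  and \<open>\<gamma>\<^sup>r\<^sub>k\<^sub>j \<xi>\<^sup>k\<^sub>r\<close> cancel, and the
  right-hand side gives \<open>n + 1 - 1\<close> times \<open>A\<^sub>j\<close>. The index of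
  \<open>A\<^sub>j\<close>, skew-symmetrized with the \<open>r\<close> form indices, is the shift by
  one step. Two obstacles shape the argument. The lift is a Hilbert choice at each point, whose
  definition gives no smoothness of the third order components, so these may appear only
  undifferentiated; and without a lift even the lower order components of the choice would be
  arbitrary. Existence of the lift in turn requires differentiating equations whose parameters
  \<open>A\<close> and \<open>a\<close> are only asserted to exist point by point; contractions
  express both through the jet and thereby make them smooth functions.\<close>

lemma pd_eqI: "(f has_derivative f') (at x) \<Longrightarrow> pd i f x = f' (axis i 1)"
  unfolding pd_def by (metis frechet_derivative_at)

lemma frechet_derivative_eq_sum_pd:
  assumes "f differentiable (at x)"
  shows "frechet_derivative f (at x) h = (\<Sum>i\<in>UNIV. h $ i * pd i f x)"
proof -
  have lin: "linear (frechet_derivative f (at x))"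
    using assms by (rule linear_frechet_derivative)
  have "frechet_derivative f (at x) h = frechet_derivative f (at x) (\<Sum>i\<in>UNIV. h $ i *\<^sub>R axis i 1)"
    by (simp add: basis_expansion [of h, unfolded scalar_mult_eq_scaleR])
  then show ?thesis
    by (simp add: linear_sum [OF lin] linear_scale [OF lin] pd_def)
qed

lemma has_derivative_pd:
  assumes "f differentiable (at x)"
  shows "(f has_derivative (\<lambda>h. \<Sum>i\<in>UNIV. h $ i * pd i f x)) (at x)"
proof -
  have "(\<lambda>h. \<Sum>i\<in>UNIV. h $ i * pd i f x) = frechet_derivative f (at x)"
    using frechet_derivative_eq_sum_pd [OF assms] by auto
  then show ?thesis
    using assms by (simp add: frechet_derivative_works [symmetric])
qed

lemma pd_const [simp]: "pd i (\<lambda>x. c) x = 0"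
  by (simp add: pd_def)

lemma pd_add:
  assumes "f differentiable (at x)" "g differentiable (at x)"
  shows "pd i (\<lambda>y. f y + g y) x = pd i f x + pd i g x"
proof -
  have "((\<lambda>y. f y + g y) has_derivative (\<lambda>h. frechet_derivative f (at x) h
      + frechet_derivative g (at x) h)) (at x)"
    using assms unfolding frechet_derivative_works by (rule has_derivative_add)
  from pd_eqI [OF this] show ?thesis
    by (simp add: pd_def)
qed

lemma pd_mult:
  assumes "f differentiable (at x)" "g differentiable (at x)"
  shows "pd i (\<lambda>y. f y * g y) x = pd i f x * g x + f x * pd i g x"
proof -
  have "((\<lambda>y. f y * g y) has_derivative (\<lambda>h. f x * frechet_derivative g (at x) h
      + frechet_derivative f (at x) h * g x)) (at x)"
    using assms unfolding frechet_derivative_works by (rule has_derivative_mult)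
  from pd_eqI [OF this] show ?thesis
    by (simp add: pd_def)
qed

lemma pd_cmult:
  assumes "f differentiable (at x)"
  shows "pd i (\<lambda>y. c * f y) x = c * pd i f x"
  using pd_mult [of "\<lambda>y. c" x f i] assms by simp

lemma pd_inverse:
  assumes "f differentiable (at x)" "f x \<noteq> 0"
  shows "pd i (\<lambda>y. inverse (f y)) x = - (inverse (f x) * pd i f x * inverse (f x))"
proof -
  have "((\<lambda>y. inverse (f y)) has_derivative
      (\<lambda>h. - (inverse (f x) * frechet_derivative f (at x) h * inverse (f x)))) (at x)"
    by (rule Deriv.has_derivative_inverse [OF assms(2) assms(1)[unfolded frechet_derivative_works]])
  from pd_eqI [OF this] show ?thesis
    by (simp add: pd_def)
qed

lemma pd_sum:
  assumes "\<And>a. a \<in> A \<Longrightarrow> f a differentiable (at x)"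
  shows "pd i (\<lambda>y. \<Sum>a\<in>A. f a y) x = (\<Sum>a\<in>A. pd i (f a) x)"
proof -
  have "((\<lambda>y. \<Sum>a\<in>A. f a y) has_derivative (\<lambda>h. \<Sum>a\<in>A. frechet_derivative (f a) (at x) h)) (at x)"
    using assms unfolding frechet_derivative_works by (intro has_derivative_sum)
  from pd_eqI [OF this] show ?thesis
    by (simp add: pd_def)
qed

lemma pd_cong:
  assumes "open S" "x \<in> S" "\<And>y. y \<in> S \<Longrightarrow> f y = g y"
  shows "pd i f x = pd i g x"
proof -
  have "(f has_derivative f') (at x) \<longleftrightarrow> (g has_derivative f') (at x)" for f'
    using has_derivative_transform_within_open [OF _ assms(1,2), of f f' UNIV g]
      has_derivative_transform_within_open [OF _ assms(1,2), of g f' UNIV f] assms(3) by auto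
  then show ?thesis
    by (simp add: pd_def frechet_derivative_def)
qed

lemma differentiable_cong_open:
  assumes "open S" "x \<in> S" "\<And>y. y \<in> S \<Longrightarrow> f y = g y" "f differentiable (at x)"
  shows "g differentiable (at x)"
  using assms has_derivative_transform_within_open unfolding differentiable_def by blast

text \<open>Restriction to a coordinate line reduces a partial derivative to an ordinary one. This
  serves the mean value argument for mixed derivatives and the formal derivatives in
  \<open>conf3\<close>, which are taken along such lines.\<close>

lemma pd_line:
  assumes "f differentiable (at (x + t *\<^sub>R axis i 1))"
  shows "((\<lambda>s. f (x + s *\<^sub>R axis i 1)) has_real_derivative pd i f (x + t *\<^sub>R axis i 1)) (at t)"
proof -
  let ?y = "x + t *\<^sub>R axis i 1"
  have d: "(f has_derivative frechet_derivative f (at ?y)) (at ?y)"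
    using assms unfolding frechet_derivative_works .
  have l: "((\<lambda>s. x + s *\<^sub>R axis i 1) has_derivative (\<lambda>h. h *\<^sub>R axis i 1)) (at t)"
    by (auto intro!: derivative_eq_intros)
  have "linear (frechet_derivative f (at ?y))"
    using assms by (rule linear_frechet_derivative)
  then have "(\<lambda>h. frechet_derivative f (at ?y) (h *\<^sub>R axis i 1)) = (*) (pd i f ?y)"
    by (auto simp: linear_scale pd_def)
  then show ?thesis
    using has_derivative_compose [OF l d] by (simp add: has_field_derivative_def)
qed

lemma pd_compose:
  fixes T :: "real^'n::finite \<Rightarrow> real^'m::finite"
  assumes T: "\<And>m. (\<lambda>y. T y $ m) differentiable (at x)" and f: "f differentiable (at (T x))"
  shows "(\<lambda>y. f (T y)) differentiable (at x)"
    and "pd i (\<lambda>y. f (T y)) x = (\<Sum>m\<in>UNIV. pd i (\<lambda>y. T y $ m) x * pd m f (T x))"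
proof -
  let ?T' = "\<lambda>h. \<chi> m. frechet_derivative (\<lambda>y. T y $ m) (at x) h"
  have "(T has_derivative ?T') (at x)"
    unfolding has_derivative_componentwise_within [of T]
    using T by (auto simp: Basis_vec_def inner_axis frechet_derivative_works [symmetric])
  from has_derivative_compose [OF this has_derivative_pd [OF f]]
  have *: "((\<lambda>y. f (T y)) has_derivative (\<lambda>h. \<Sum>m\<in>UNIV. ?T' h $ m * pd m f (T x))) (at x)" .
  then show "(\<lambda>y. f (T y)) differentiable (at x)"
    by (rule differentiableI)
  show "pd i (\<lambda>y. f (T y)) x = (\<Sum>m\<in>UNIV. pd i (\<lambda>y. T y $ m) x * pd m f (T x))"
    using pd_eqI [OF *, of i] by (simp add: pd_def)
qed

section \<open>Iterated derivatives and closure properties of the smooth functions\<close>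

lemma pds_append: "pds (is @ js) f = pds is (pds js f)"
  by (induction "is") auto

lemma pds_cong:
  assumes "open S" "\<And>y. y \<in> S \<Longrightarrow> f y = g y" "x \<in> S"
  shows "pds is f x = pds is g x"
  using assms(3)
proof (induction "is" arbitrary: x)
  case (Cons i "is")
  then show ?case
    using pd_cong [OF assms(1) Cons.prems, of "pds is f" "pds is g"] by simp
qed (simp add: assms(2))

lemma smooth_on_differentiable: "smooth_on S f \<Longrightarrow> x \<in> S \<Longrightarrow> f differentiable (at x)"
  unfolding smooth_on_def by (metis pds.simps(1))

lemma smooth_on_subset: "smooth_on S f \<Longrightarrow> S' \<subseteq> S \<Longrightarrow> smooth_on S' f"
  unfolding smooth_on_def by blast

lemma smooth_on_pds: "smooth_on S f \<Longrightarrow> smooth_on S (pds js f)"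
  unfolding smooth_on_def by (metis pds_append)

lemma smooth_on_pd: "smooth_on S f \<Longrightarrow> smooth_on S (pd i f)"
  using smooth_on_pds [of S f "[i]"] by simp

lemma smooth_on_cong:
  assumes "open S" "\<And>y. y \<in> S \<Longrightarrow> f y = g y" "smooth_on S f"
  shows "smooth_on S g"
  unfolding smooth_on_def
proof (intro allI ballI)
  fix "is" x assume x: "x \<in> S"
  have "pds is f differentiable (at x)"
    using assms(3) x by (simp add: smooth_on_def)
  then show "pds is g differentiable (at x)"
    using differentiable_cong_open [OF assms(1) x, of "pds is f" "pds is g"]
      pds_cong [OF assms(1), of f g _ "is"] assms(2) by blast
qed

text \<open>A class of differentiable functions that is closed under every \<open>pd\<close>, up to
  equality on the open set, consists of smooth functions. This avoids any formula for iterated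
  derivatives of products or inverses.\<close>

lemma smooth_on_coinduct:
  assumes "open S" "P f"
    and "\<And>f x. P f \<Longrightarrow> x \<in> S \<Longrightarrow> f differentiable (at x)"
    and "\<And>f i. P f \<Longrightarrow> \<exists>h. P h \<and> (\<forall>x\<in>S. pd i f x = h x)"
  shows "smooth_on S f"
proof -
  \<comment> \<open>The induction strips the innermost derivative, the last entry of the list,
    because that is the one applied to a member of the class.\<close>
  have "\<forall>f. P f \<longrightarrow> (\<forall>x\<in>S. pds is f differentiable (at x))" for "is"
  proof (induction "is" rule: rev_induct)
    case Nil
    then show ?case using assms(3) by simp
  next
    case (snoc i "is")
    show ?case
    proof (intro allI impI ballI)
      fix f x assume f: "P f" and x: "x \<in> S"
      obtain h where h: "P h" "\<And>x. x \<in> S \<Longrightarrow> pd i f x = h x"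
        using assms(4) [OF f] by blast
      have "pds is h differentiable (at x)"
        using snoc h(1) x by blast
      then show "pds (is @ [i]) f differentiable (at x)"
        using differentiable_cong_open [OF assms(1) x pds_cong [OF assms(1), of h "pd i f"]] h(2)
        by (simp add: pds_append)
    qed
  qed
  then show ?thesis
    using assms(2) by (simp add: smooth_on_def)
qed

text \<open>The derivative of a product or an inverse mixes sums, products and inverses, so the
  operations are closed up together; the resulting class is then invariant under
  \<open>pd\<close>.\<close>

inductive smooth_closure :: "(real^'n::finite) set \<Rightarrow> (real^'n \<Rightarrow> real) \<Rightarrow> bool" for S where
  base: "smooth_on S f \<Longrightarrow> smooth_closure S f"
| const: "smooth_closure S (\<lambda>x. c)"
| add: "smooth_closure S f \<Longrightarrow> smooth_closure S g \<Longrightarrow> smooth_closure S (\<lambda>x. f x + g x)"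
| mult: "smooth_closure S f \<Longrightarrow> smooth_closure S g \<Longrightarrow> smooth_closure S (\<lambda>x. f x * g x)"
| inverse: "smooth_closure S f \<Longrightarrow> (\<And>x. x \<in> S \<Longrightarrow> f x \<noteq> 0) \<Longrightarrow>
    smooth_closure S (\<lambda>x. inverse (f x))"

lemma smooth_closure_imp_smooth_on:
  assumes S: "open S" and f: "smooth_closure S f"
  shows "smooth_on S f"
proof -
  have d: "f differentiable (at x)" if "smooth_closure S f" "x \<in> S" for f x
    using that by induction (auto intro: smooth_on_differentiable)
  have p: "\<exists>h. smooth_closure S h \<and> (\<forall>x\<in>S. pd i f x = h x)" if "smooth_closure S f" for f i
    using that
  proof induction
    case (base f)
    then show ?case
      using smooth_on_pd smooth_closure.base by blast
  next
    case (const c)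
    then show ?case
      by (auto intro!: exI [of _ "\<lambda>x. 0"] smooth_closure.const)
  next
    case (add f g)
    then obtain f' g' where fg: "smooth_closure S f'" "\<And>x. x \<in> S \<Longrightarrow> pd i f x = f' x"
        "smooth_closure S g'" "\<And>x. x \<in> S \<Longrightarrow> pd i g x = g' x"
      by blast
    show ?case
      by (rule exI [of _ "\<lambda>x. f' x + g' x"])
        (use fg add.hyps in \<open>auto simp: pd_add d intro: smooth_closure.add\<close>)
  next
    case (mult f g)
    then obtain f' g' where fg: "smooth_closure S f'" "\<And>x. x \<in> S \<Longrightarrow> pd i f x = f' x"
        "smooth_closure S g'" "\<And>x. x \<in> S \<Longrightarrow> pd i g x = g' x"
      by blast
    show ?case
      by (rule exI [of _ "\<lambda>x. f' x * g x + f x * g' x"])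
        (use fg mult.hyps in \<open>auto simp: pd_mult d intro!: smooth_closure.add smooth_closure.mult\<close>)
  next
    case (inverse f)
    then obtain f' where fg: "smooth_closure S f'" "\<And>x. x \<in> S \<Longrightarrow> pd i f x = f' x"
      by blast
    have "smooth_closure S (\<lambda>x. (-1) * (inverse (f x) * f' x * inverse (f x)))"
      using fg inverse.hyps by (intro smooth_closure.mult smooth_closure.inverse smooth_closure.const)
    then show ?case
      using fg inverse.hyps by (intro exI conjI) (auto simp: pd_inverse d)
  qed
  show ?thesis
    using S f d p by (rule smooth_on_coinduct)
qed

context
  fixes S :: "(real^'n::finite) set"
  assumes S: "open S"
begin

lemma smooth_on_const: "smooth_on S (\<lambda>x. c)"
  by (rule smooth_closure_imp_smooth_on [OF S smooth_closure.const])

lemma smooth_on_add: "smooth_on S f \<Longrightarrow> smooth_on S g \<Longrightarrow> smooth_on S (\<lambda>x. f x + g x)"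
  by (intro smooth_closure_imp_smooth_on S smooth_closure.add) (rule smooth_closure.base; assumption)+

lemma smooth_on_mult: "smooth_on S f \<Longrightarrow> smooth_on S g \<Longrightarrow> smooth_on S (\<lambda>x. f x * g x)"
  by (intro smooth_closure_imp_smooth_on S smooth_closure.mult) (rule smooth_closure.base; assumption)+

lemma smooth_on_inverse:
  "smooth_on S f \<Longrightarrow> (\<And>x. x \<in> S \<Longrightarrow> f x \<noteq> 0) \<Longrightarrow> smooth_on S (\<lambda>x. inverse (f x))"
  using smooth_closure_imp_smooth_on [OF S smooth_closure.inverse [OF smooth_closure.base, of S f]] by blast

lemma smooth_on_diff: "smooth_on S f \<Longrightarrow> smooth_on S g \<Longrightarrow> smooth_on S (\<lambda>x. f x - g x)"
  using smooth_on_add [of f "\<lambda>x. (-1) * g x"] smooth_on_mult [OF smooth_on_const, of g "-1"] by simp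

lemma smooth_on_divide:
  "smooth_on S f \<Longrightarrow> smooth_on S g \<Longrightarrow> (\<And>x. x \<in> S \<Longrightarrow> g x \<noteq> 0) \<Longrightarrow>
    smooth_on S (\<lambda>x. f x / g x)"
  using smooth_on_mult [of f "\<lambda>x. inverse (g x)"] smooth_on_inverse [of g] by (simp add: divide_inverse)

lemma smooth_on_sum: "(\<And>a. a \<in> A \<Longrightarrow> smooth_on S (f a)) \<Longrightarrow> smooth_on S (\<lambda>x. \<Sum>a\<in>A. f a x)"
  by (induction A rule: infinite_finite_induct) (auto intro: smooth_on_const smooth_on_add)

lemma smooth_on_prod: "(\<And>a. a \<in> A \<Longrightarrow> smooth_on S (f a)) \<Longrightarrow> smooth_on S (\<lambda>x. \<Prod>a\<in>A. f a x)"
  by (induction A rule: infinite_finite_induct) (auto intro: smooth_on_const smooth_on_mult)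

lemmas smooth_on_intros =
  smooth_on_const smooth_on_add smooth_on_mult smooth_on_diff smooth_on_sum

end

text \<open>Schwarz's theorem. The second difference over a small square, divided by the square of
  its side, is a value of either mixed derivative inside the square. Shrinking the square gives
  equality at \<open>x\<close>, as both mixed derivatives are continuous there, being
  differentiable.\<close>

lemma pd_commute:
  assumes S: "open S" and f: "smooth_on S f" and x: "x \<in> S"
  shows "pd i (pd j f) x = pd j (pd i f) x"
proof -
  obtain e where e: "e > 0" "ball x e \<subseteq> S"
    using S x open_contains_ball by blast
  define p where "p s t = x + s *\<^sub>R axis i 1 + t *\<^sub>R axis j (1::real)" for s t
  have pS: "p s t \<in> S" if "\<bar>s\<bar> < e / 2" "\<bar>t\<bar> < e / 2" for s t
  proof -
    have "dist x (p s t) \<le> \<bar>s\<bar> + \<bar>t\<bar>"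
      using norm_triangle_ineq [of "s *\<^sub>R axis i (1::real)" "t *\<^sub>R axis j 1"]
      by (simp add: p_def dist_norm add.assoc norm_minus_commute add.commute)
    then show ?thesis
      using that e by auto
  qed
  have D1: "((\<lambda>s. h (p s t)) has_real_derivative pd i h (p s t)) (at s)"
    if "smooth_on S h" "\<bar>s\<bar> < e / 2" "\<bar>t\<bar> < e / 2" for h s t
    using pd_line [of h "x + t *\<^sub>R axis j 1" s i] smooth_on_differentiable [OF that(1) pS [OF that(2,3)]]
    by (simp add: p_def add_ac)
  have D2: "((\<lambda>t. h (p s t)) has_real_derivative pd j h (p s t)) (at t)"
    if "smooth_on S h" "\<bar>s\<bar> < e / 2" "\<bar>t\<bar> < e / 2" for h s t
    using pd_line [of h "x + s *\<^sub>R axis i 1" t j] smooth_on_differentiable [OF that(1) pS [OF that(2,3)]]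
    by (simp add: p_def add_ac)
  have sm: "smooth_on S (pd i f)" "smooth_on S (pd j f)"
    using f smooth_on_pd by auto
  \<comment> \<open>Both mixed derivatives are values of the same second difference quotient.\<close>
  have ex: "\<exists>s t s' t'. 0 < s \<and> s < h \<and> 0 < t \<and> t < h \<and> 0 < s' \<and> s' < h \<and> 0 < t' \<and> t' < h \<and>
      pd j (pd i f) (p s t) = pd i (pd j f) (p s' t')" if h: "0 < h" "h < e / 2" for h
  proof -
    have "\<exists>s. 0 < s \<and> s < h \<and> (f (p h h) - f (p h 0)) - (f (p 0 h) - f (p 0 0))
        = (h - 0) * (pd i f (p s h) - pd i f (p s 0))"
      by (rule MVT2 [of 0 h "\<lambda>s. f (p s h) - f (p s 0)"])
        (use h in \<open>auto intro!: DERIV_diff D1 f\<close>)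
    then obtain s where s: "0 < s" "s < h" "(f (p h h) - f (p h 0)) - (f (p 0 h) - f (p 0 0))
        = h * (pd i f (p s h) - pd i f (p s 0))"
      by auto
    have "\<exists>t. 0 < t \<and> t < h \<and> pd i f (p s h) - pd i f (p s 0) = (h - 0) * pd j (pd i f) (p s t)"
      by (rule MVT2) (use h s in \<open>auto intro!: D2 sm\<close>)
    then obtain t where t: "0 < t" "t < h" "pd i f (p s h) - pd i f (p s 0) = h * pd j (pd i f) (p s t)"
      by auto
    have "\<exists>t. 0 < t \<and> t < h \<and> (f (p h h) - f (p 0 h)) - (f (p h 0) - f (p 0 0))
        = (h - 0) * (pd j f (p h t) - pd j f (p 0 t))"
      by (rule MVT2 [of 0 h "\<lambda>t. f (p h t) - f (p 0 t)"])
        (use h in \<open>auto intro!: DERIV_diff D2 f\<close>)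
    then obtain t' where t': "0 < t'" "t' < h" "(f (p h h) - f (p 0 h)) - (f (p h 0) - f (p 0 0))
        = h * (pd j f (p h t') - pd j f (p 0 t'))"
      by auto
    have "\<exists>s. 0 < s \<and> s < h \<and> pd j f (p h t') - pd j f (p 0 t') = (h - 0) * pd i (pd j f) (p s t')"
      by (rule MVT2) (use h t' in \<open>auto intro!: D1 sm\<close>)
    then obtain s' where s': "0 < s'" "s' < h" "pd j f (p h t') - pd j f (p 0 t') = h * pd i (pd j f) (p s' t')"
      by auto
    have "f (p h h) - f (p h 0) - (f (p 0 h) - f (p 0 0)) = h * (h * pd j (pd i f) (p s t))"
      using s(3) t(3) by simp
    moreover have "f (p h h) - f (p 0 h) - (f (p h 0) - f (p 0 0)) = h * (h * pd i (pd j f) (p s' t'))"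
      using s'(3) t'(3) by simp
    ultimately have "h * (h * pd j (pd i f) (p s t)) = h * (h * pd i (pd j f) (p s' t'))"
      by linarith
    then show ?thesis
      using s t s' t' h by auto
  qed
  \<comment> \<open>The factor \<open>e / 4\<close> keeps the sides strictly below
    \<open>e / 2\<close>, so that the corners of the square also lie in the region covered by
    \<open>pS\<close>.\<close>
  define h where "h n = e / 4 * inverse (real (Suc n))" for n :: nat
  have h: "0 < h n" "h n < e / 2" for n
    using e by (auto simp: h_def field_simps add_pos_nonneg)
  have h0: "h \<longlonglongrightarrow> 0"
    unfolding h_def using tendsto_mult_right_zero [OF LIMSEQ_inverse_real_of_nat] .
  have "\<exists>s t s' t'. \<forall>n. (0 < s n \<and> s n < h n \<and> 0 < t n \<and> t n < h n) \<and>
      (0 < s' n \<and> s' n < h n \<and> 0 < t' n \<and> t' n < h n) \<and>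
      pd j (pd i f) (p (s n) (t n)) = pd i (pd j f) (p (s' n) (t' n))"
    using ex [OF h] by metis
  then obtain s t s' t' where st: "\<And>n. 0 < s n \<and> s n < h n \<and> 0 < t n \<and> t n < h n"
      and st': "\<And>n. 0 < s' n \<and> s' n < h n \<and> 0 < t' n \<and> t' n < h n"
      and eq: "\<And>n. pd j (pd i f) (p (s n) (t n)) = pd i (pd j f) (p (s' n) (t' n))"
    by blast
  have lim: "(\<lambda>n. g (p (s n) (t n))) \<longlonglongrightarrow> g x"
    if "smooth_on S g" "\<And>n. 0 < s n \<and> s n < h n \<and> 0 < t n \<and> t n < h n" for g s t
  proof -
    have "s \<longlonglongrightarrow> 0" "t \<longlonglongrightarrow> 0"
      using that(2) by (auto intro!: tendsto_sandwich [OF _ _ tendsto_const h0] always_eventually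
          simp: less_imp_le)
    then have "(\<lambda>n. p (s n) (t n)) \<longlonglongrightarrow> x + 0 *\<^sub>R axis i 1 + 0 *\<^sub>R axis j 1"
      unfolding p_def by (intro tendsto_intros)
    moreover have "isCont g x"
      using smooth_on_differentiable [OF that(1) x] differentiable_imp_continuous_within by blast
    ultimately show ?thesis
      using isCont_tendsto_compose [of x g "\<lambda>n. p (s n) (t n)" sequentially] by simp
  qed
  show ?thesis
    using lim [OF smooth_on_pd [OF sm(1)] st, of j] lim [OF smooth_on_pd [OF sm(2)] st', of i] eq
      LIMSEQ_unique by (metis (no_types, lifting) ext)
qed

text \<open>Jets are indexed by multisets, \<open>pds\<close> by lists; this reconciles the two. If
  the heads differ, each tail is rearranged to begin with the head of the other list, and Schwarz's
  theorem exchanges the two outermost derivatives. The rearranged tails are not sublists, hence the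
  induction on length.\<close>

lemma pds_mset_cong:
  assumes "open S" "smooth_on S f" "x \<in> S" "mset is = mset js"
  shows "pds is f x = pds js f x"
  using assms(4,3)
proof (induction "is" arbitrary: js x rule: length_induct)
  case (1 "is" js)
  show ?case
  proof (cases "is")
    case Nil
    then show ?thesis using 1 by simp
  next
    case (Cons i is')
    then obtain j js' where js: "js = j # js'"
      using 1 by (cases js) auto
    have len: "length is' = length js'"
      using 1(2) Cons js by (metis length_Cons nat.inject size_mset)
    show ?thesis
    proof (cases "i = j")
      case True
      have "pds is' f y = pds js' f y" if "y \<in> S" for y
        using 1(1)[rule_format, of is' js' y] 1(2) Cons js True that by simp
      then show ?thesis
        using pd_cong [OF assms(1) 1(3), of "pds is' f" "pds js' f"] True Cons js by simp
    next
      case False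
      then obtain K where "mset js' = add_mset i K" "mset is' = add_mset j K"
        using 1(2) Cons js by (auto simp: add_eq_conv_ex)
      then obtain ks where ks: "mset js' = mset (i # ks)" "mset is' = mset (j # ks)"
        using ex_mset [of K] by auto
      have a: "pds is' f y = pds (j # ks) f y" if "y \<in> S" for y
        using 1(1)[rule_format, of is' "j # ks" y] Cons ks that by simp
      have b: "pds js' f y = pds (i # ks) f y" if "y \<in> S" for y
        using 1(1)[rule_format, of js' "i # ks" y] Cons len ks that by simp
      have "pds is f x = pd i (pd j (pds ks f)) x"
        using pd_cong [OF assms(1) 1(3), of "pds is' f" "pds (j # ks) f"] a Cons by simp
      also have "\<dots> = pd j (pd i (pds ks f)) x"
        using pd_commute [OF assms(1) smooth_on_pds [OF assms(2)] 1(3)] .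
      also have "\<dots> = pds js f x"
        using pd_cong [OF assms(1) 1(3), of "pds js' f" "pds (i # ks) f"] b js by simp
      finally show ?thesis .
    qed
  qed
qed

subsection \<open>Matrix-valued functions and the logarithmic derivative of the density\<close>

lemma matrix_inv:
  fixes A :: "real^'n^'n"
  assumes "det A \<noteq> 0"
  shows matrix_inv_right: "A ** matrix_inv A = mat 1" and matrix_inv_left: "matrix_inv A ** A = mat 1"
proof -
  have "\<exists>B. A ** B = mat 1 \<and> B ** A = mat 1"
    using assms by (simp add: invertible_det_nz [symmetric] invertible_def)
  then have "A ** matrix_inv A = mat 1 \<and> matrix_inv A ** A = mat 1"
    unfolding matrix_inv_def by (rule someI_ex)
  then show "A ** matrix_inv A = mat 1" "matrix_inv A ** A = mat 1" by auto
qed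

lemma matrix_inv_unique:
  fixes A B :: "real^'n^'n"
  assumes "A ** B = mat 1"
  shows "matrix_inv A = B"
proof -
  have "det A \<noteq> 0"
    using assms by (metis det_I det_mul mult_zero_left zero_neq_one)
  then show ?thesis
    by (metis assms matrix_inv_left matrix_mul_assoc matrix_mul_lid matrix_mul_rid)
qed

text \<open>Quotients of determinants are visibly smooth in the entries, which is how smoothness of
  the inverse metric is obtained.\<close>

lemma matrix_inv_cramer:
  fixes A :: "real^'n^'n"
  assumes "det A \<noteq> 0"
  shows "matrix_inv A $ k $ r = det (\<chi> i j. if j = k then of_bool (i = r) else A $ i $ j) / det A"
proof -
  have "A *v (matrix_inv A *v axis r 1) = axis r 1"
    by (simp add: matrix_vector_mul_assoc matrix_inv_right [OF assms])
  then have "matrix_inv A *v axis r 1 =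
      (\<chi> k. det (\<chi> i j. if j = k then axis r 1 $ i else A $ i $ j) / det A)"
    using cramer [OF assms] by blast
  then have "(matrix_inv A *v axis r 1) $ k =
      det (\<chi> i j. if j = k then axis r 1 $ i else A $ i $ j) / det A"
    by simp
  moreover have "(\<chi> i j. if j = k then axis r 1 $ i else A $ i $ j) =
      (\<chi> i j. if j = k then of_bool (i = r) else A $ i $ j)"
    by (simp add: vec_eq_iff axis_def)
  ultimately show ?thesis
    by (simp add: matrix_vector_mult_basis column_def)
qed

section \<open>Entrywise calculus of matrix-valued functions\<close>

definition smooth_matrix_on :: "(real^'n::finite) set \<Rightarrow> (real^'n \<Rightarrow> real^'k^'m) \<Rightarrow> bool" where
  "smooth_matrix_on S A \<longleftrightarrow> (\<forall>i j. smooth_on S (\<lambda>x. A x $ i $ j))"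

lemma smooth_on_det:
  assumes "open S" "smooth_matrix_on S A"
  shows "smooth_on S (\<lambda>x. det (A x))"
  unfolding det_def using assms
  by (intro smooth_on_sum smooth_on_mult smooth_on_const smooth_on_prod)
    (auto simp: smooth_matrix_on_def)

lemma smooth_matrix_on_inv:
  assumes "open S" "smooth_matrix_on S A" "\<forall>x\<in>S. det (A x) \<noteq> 0"
  shows "smooth_matrix_on S (\<lambda>x. matrix_inv (A x))"
  unfolding smooth_matrix_on_def
proof (intro allI)
  fix k r
  have "smooth_on S (\<lambda>x. if j = k then of_bool (i = r) else A x $ i $ j)" for i j
    using assms by (cases "j = k") (auto simp: smooth_on_const smooth_matrix_on_def)
  then have "smooth_on S (\<lambda>x. det (\<chi> i j. if j = k then of_bool (i = r) else A x $ i $ j) / det (A x))"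
    using assms by (intro smooth_on_divide smooth_on_det) (auto simp: smooth_matrix_on_def)
  then show "smooth_on S (\<lambda>x. matrix_inv (A x) $ k $ r)"
    by (rule smooth_on_cong [OF assms(1), rotated]) (simp add: matrix_inv_cramer bspec [OF assms(3)])
qed

definition mpd :: "'n::finite \<Rightarrow> (real^'n \<Rightarrow> real^'k^'m) \<Rightarrow> real^'n \<Rightarrow> real^'k^'m" where
  "mpd i A x = (\<chi> a b. pd i (\<lambda>y. A y $ a $ b) x)"

definition mdiff :: "(real^'n::finite \<Rightarrow> real^'k^'m) \<Rightarrow> real^'n \<Rightarrow> bool" where
  "mdiff A x \<longleftrightarrow> (\<forall>a b. (\<lambda>y. A y $ a $ b) differentiable (at x))"

lemma smooth_matrix_on_mdiff: "smooth_matrix_on S A \<Longrightarrow> x \<in> S \<Longrightarrow> mdiff A x"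
  unfolding smooth_matrix_on_def mdiff_def using smooth_on_differentiable by blast

lemma smooth_matrix_on_mpd: "smooth_matrix_on S A \<Longrightarrow> smooth_matrix_on S (mpd i A)"
  unfolding smooth_matrix_on_def mpd_def by (auto intro: smooth_on_pd)

lemma mpd_commute:
  "open S \<Longrightarrow> smooth_matrix_on S A \<Longrightarrow> x \<in> S \<Longrightarrow> mpd i (mpd j A) x = mpd j (mpd i A) x"
  unfolding smooth_matrix_on_def mpd_def by (simp add: pd_commute)

lemma mpd_cong:
  assumes "open S" "x \<in> S" "\<And>y. y \<in> S \<Longrightarrow> A y = B y"
  shows "mpd i A x = mpd i B x"
proof -
  have "pd i (\<lambda>y. A y $ a $ b) x = pd i (\<lambda>y. B y $ a $ b) x" for a b
    by (rule pd_cong [OF assms(1,2)]) (simp add: assms(3))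
  then show ?thesis
    by (simp add: mpd_def)
qed

lemma mdiff_mult: "mdiff A x \<Longrightarrow> mdiff B x \<Longrightarrow> mdiff (\<lambda>y. A y ** B y) x"
  unfolding mdiff_def matrix_matrix_mult_def by (auto intro!: differentiable_sum differentiable_mult)

lemma mpd_mult:
  assumes "mdiff A x" "mdiff B x"
  shows "mpd i (\<lambda>y. A y ** B y) x = mpd i A x ** B x + A x ** mpd i B x"
  using assms unfolding mdiff_def
  by (simp add: vec_eq_iff mpd_def matrix_matrix_mult_def pd_sum pd_mult sum.distrib differentiable_mult)

lemma mdiff_transpose: "mdiff A x \<Longrightarrow> mdiff (\<lambda>y. transpose (A y)) x"
  by (simp add: mdiff_def transpose_def)

lemma mpd_transpose: "mpd i (\<lambda>y. transpose (A y)) x = transpose (mpd i A x)"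
  by (simp add: vec_eq_iff mpd_def transpose_def)

lemma pd_trace:
  assumes "mdiff A x"
  shows "pd i (\<lambda>y. trace (A y)) x = trace (mpd i A x)"
  using assms unfolding trace_def mpd_def mdiff_def by (simp add: pd_sum)

lemma matrix_add_rdistrib: "((A :: real^'n^'m) + B) ** C = A ** C + B ** C"
  by (simp add: matrix_matrix_mult_def vec_eq_iff sum.distrib distrib_right)

lemma matrix_uminus_mult: "(- (A :: real^'n^'m)) ** B = - (A ** B)"
  by (simp add: matrix_matrix_mult_def vec_eq_iff sum_negf)

lemma mpd_matrix_inv:
  assumes S: "open S" and A: "smooth_matrix_on S A" "\<forall>x\<in>S. det (A x) \<noteq> 0" and x: "x \<in> S"
  shows "mpd i (\<lambda>y. matrix_inv (A y)) x = - (matrix_inv (A x) ** mpd i A x ** matrix_inv (A x))"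
proof -
  let ?I = "\<lambda>y. matrix_inv (A y)"
  have d: "mdiff ?I x" "mdiff A x"
    using A x S by (auto intro: smooth_matrix_on_mdiff smooth_matrix_on_inv)
  have "mpd i (\<lambda>y. ?I y ** A y) x = mpd i (\<lambda>y. mat 1) x"
    using S x by (rule mpd_cong) (simp add: matrix_inv_left A(2))
  then have "mpd i ?I x ** A x + ?I x ** mpd i A x = 0"
    using d by (simp add: mpd_mult) (simp add: mpd_def vec_eq_iff)
  then have "(mpd i ?I x ** A x + ?I x ** mpd i A x) ** ?I x = 0"
    by simp
  then have "(mpd i ?I x ** A x) ** ?I x = - ((?I x ** mpd i A x) ** ?I x)"
    by (simp add: matrix_add_rdistrib eq_neg_iff_add_eq_0)
  then show ?thesis
    using A(2) x by (simp add: matrix_mul_assoc [symmetric] matrix_inv_right)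
qed

text \<open>The trace \<open>\<gamma>\<^sup>s\<^sub>s\<^sub>i\<close> of the Christoffel symbols, in the form \<open>1/2 tr (g\<^sup>-\<^sup>1 \<partial>\<^sub>i g)\<close>, which avoids
  logarithms and determinants.\<close>

definition gam :: "(real^'n::finite \<Rightarrow> real^'n^'n) \<Rightarrow> 'n \<Rightarrow> real^'n \<Rightarrow> real" where
  "gam g i x = 1/2 * trace (matrix_inv (g x) ** mpd i g x)"

lemma smooth_matrix_on_mult:
  "open S \<Longrightarrow> smooth_matrix_on S A \<Longrightarrow> smooth_matrix_on S B \<Longrightarrow> smooth_matrix_on S (\<lambda>x. A x ** B x)"
  unfolding smooth_matrix_on_def matrix_matrix_mult_def
  by (auto intro!: smooth_on_sum smooth_on_mult)

lemma smooth_on_gam: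
  assumes "open S" "smooth_matrix_on S g" "\<forall>x\<in>S. det (g x) \<noteq> 0"
  shows "smooth_on S (gam g i)"
proof -
  have "smooth_matrix_on S (\<lambda>x. matrix_inv (g x) ** mpd i g x)"
    using assms by (intro smooth_matrix_on_mult smooth_matrix_on_inv smooth_matrix_on_mpd)
  then have "smooth_on S (\<lambda>x. 1/2 * trace (matrix_inv (g x) ** mpd i g x))"
    unfolding trace_def using assms(1)
    by (intro smooth_on_mult smooth_on_const smooth_on_sum) (auto simp: smooth_matrix_on_def)
  then show ?thesis
    by (simp add: gam_def [abs_def])
qed

lemma trace_uminus: "trace (- A :: real^'n^'n) = - trace A"
  by (simp add: trace_def sum_negf)

lemma pd_gam:
  assumes S: "open S" and g: "smooth_matrix_on S g" "\<forall>x\<in>S. det (g x) \<noteq> 0" and x: "x \<in> S"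
  shows "pd j (gam g i) x = 1/2 * (trace (matrix_inv (g x) ** mpd j (mpd i g) x)
    - trace (matrix_inv (g x) ** mpd j g x ** (matrix_inv (g x) ** mpd i g x)))"
proof -
  let ?I = "\<lambda>y. matrix_inv (g y)"
  have d: "mdiff ?I x" "mdiff (mpd i g) x"
    using g x S by (auto intro: smooth_matrix_on_mdiff smooth_matrix_on_inv smooth_matrix_on_mpd)
  have "(\<lambda>y. trace (?I y ** mpd i g y)) differentiable (at x)"
    using mdiff_mult [OF d] unfolding trace_def mdiff_def by (auto intro!: differentiable_sum)
  then have "pd j (gam g i) x = 1/2 * trace (mpd j (\<lambda>y. ?I y ** mpd i g y) x)"
    unfolding gam_def [abs_def] by (simp only: pd_cmult pd_trace [OF mdiff_mult [OF d]])
  also have "\<dots> = 1/2 * (trace (?I x ** mpd j (mpd i g) x)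
      - trace (?I x ** mpd j g x ** (?I x ** mpd i g x)))"
    unfolding mpd_mult [OF d] mpd_matrix_inv [OF S g x] trace_add matrix_uminus_mult trace_uminus
    by (simp only: matrix_mul_assoc) simp
  finally show ?thesis .
qed

text \<open>In \<open>pd_gam\<close> the second derivatives of the metric commute, and cyclicity of
  the trace makes the quadratic term symmetric in \<open>i\<close> and \<open>j\<close>.\<close>

lemma gam_closed:
  assumes S: "open S" and g: "smooth_matrix_on S g" "\<forall>x\<in>S. det (g x) \<noteq> 0" and x: "x \<in> S"
  shows "pd j (gam g i) x = pd i (gam g j) x"
  using mpd_commute [OF S g(1) x]
    trace_mul_sym [of "matrix_inv (g x) ** mpd j g x" "matrix_inv (g x) ** mpd i g x"]
  by (simp add: pd_gam [OF S g x])

lemma trace_transpose: "trace (transpose A) = trace A"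
  by (simp add: trace_def transpose_def)

text \<open>The logarithmic derivative of \<open>det g = (det J)\<^sup>2 det G\<close>, with
  \<open>J'\<close> and \<open>G'\<close> in the role of the derivatives. The three summands come
  from the product rule; the first and the last have equal traces by transposition, since
  \<open>G\<close> and its inverse are symmetric, and this yields the factor 2.\<close>

lemma trace_pullback:
  fixes J G :: "real^'n^'n"
  assumes G: "transpose G = G" and g: "g = transpose J ** G ** J" and d: "det g \<noteq> 0"
  shows "trace (matrix_inv g ** (transpose J' ** G ** J + transpose J ** G' ** J + transpose J ** G ** J'))
    = 2 * trace (matrix_inv J ** J') + trace (matrix_inv G ** G')"
proof -
  let ?K = "matrix_inv J" and ?H = "matrix_inv G"
  have "det J \<noteq> 0" "det G \<noteq> 0"
    using d by (auto simp: g det_mul)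
  note inv = matrix_inv [OF this(1)] matrix_inv [OF this(2)]
  have K: "transpose ?K ** transpose J = mat 1" "transpose J ** transpose ?K = mat 1"
    by (simp_all add: matrix_transpose_mul [symmetric] inv transpose_mat)
  have inv': "?K ** (J ** X) = X" "J ** (?K ** X) = X" "?H ** (G ** X) = X" "G ** (?H ** X) = X"
    "transpose ?K ** (transpose J ** X) = X" "transpose J ** (transpose ?K ** X) = X" for X :: "real^'n^'n"
    by (simp_all add: matrix_mul_assoc inv K)
  have H: "transpose ?H = ?H"
    by (rule matrix_inv_unique [symmetric]) (metis G inv(4) matrix_transpose_mul transpose_mat)
  have gi: "matrix_inv g = ?K ** (?H ** transpose ?K)"
    by (rule matrix_inv_unique) (simp add: g matrix_mul_assoc [symmetric] inv' inv K)
  have 3: "matrix_inv g ** (transpose J ** G ** J') = ?K ** J'"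
    by (simp add: gi matrix_mul_assoc [symmetric] inv')
  have 2: "trace (matrix_inv g ** (transpose J ** G' ** J)) = trace (?H ** G')"
    by (simp add: gi matrix_mul_assoc [symmetric] inv' trace_mul_sym [of ?K] inv)
  have "transpose (matrix_inv g ** (transpose J' ** G ** J)) = transpose J ** (G ** (J' ** matrix_inv g))"
    using G H by (simp add: gi matrix_transpose_mul matrix_mul_assoc [symmetric])
  then have "trace (matrix_inv g ** (transpose J' ** G ** J)) =
      trace (transpose J ** (G ** (J' ** matrix_inv g)))"
    by (metis trace_transpose)
  also have "\<dots> = trace (matrix_inv g ** (transpose J ** G ** J'))"
    by (metis matrix_mul_assoc trace_mul_sym)
  finally show ?thesis
    by (simp add: matrix_add_ldistrib trace_add 2 3)
qed

lemma trace_mult_sum: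
  fixes A :: "real^'n^'n"
  shows "trace (A ** (\<Sum>m\<in>M. c m *\<^sub>R B m)) = (\<Sum>m\<in>M. c m * trace (A ** B m))"
proof (induction M rule: infinite_finite_induct)
  case (insert m M)
  have "trace (A ** (c m *\<^sub>R B m)) = c m * trace (A ** B m)"
    by (simp add: trace_def matrix_matrix_mult_def sum_distrib_left mult.left_commute)
  then show ?case
    using insert by (simp add: matrix_add_ldistrib trace_add)
qed (simp_all add: trace_def matrix_matrix_mult_def)

text \<open>The transition law of the traced Christoffel symbols. The inhomogeneous term
  \<open>trace (matrix_inv (J x) ** mpd i J x)\<close> is what the second derivatives of
  \<open>T\<close> will compensate in the divergence.\<close>

lemma gam_pullback:
  fixes T :: "real^'n::finite \<Rightarrow> real^'n"
  assumes S: "open S" and x: "x \<in> S" and T: "smooth_map_on S T"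
    and J: "J = (\<lambda>y. \<chi> k r. pd r (\<lambda>z. T z $ k) y)"
    and G: "mdiff G (T x)" "transpose (G (T x)) = G (T x)"
    and g: "\<And>y. y \<in> S \<Longrightarrow> g y = transpose (J y) ** G (T y) ** J y" and d: "det (g x) \<noteq> 0"
  shows "gam g i x = trace (matrix_inv (J x) ** mpd i J x) + (\<Sum>m\<in>UNIV. J x $ m $ i * gam G m (T x))"
proof -
  have Td: "(\<lambda>y. T y $ m) differentiable (at x)" for m
    using T x unfolding smooth_map_on_def by (blast intro: smooth_on_differentiable)
  have Jd: "mdiff J x"
    using T x unfolding J mdiff_def smooth_map_on_def
    by (auto intro: smooth_on_differentiable smooth_on_pd)
  have GTd: "mdiff (\<lambda>y. G (T y)) x"
    using G(1) Td unfolding mdiff_def by (auto intro: pd_compose(1))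
  have "pd i (\<lambda>y. G (T y) $ a $ b) x =
      (\<Sum>m\<in>UNIV. pd i (\<lambda>y. T y $ m) x * pd m (\<lambda>y. G y $ a $ b) (T x))" for a b
    using G(1) Td pd_compose(2) [of T x "\<lambda>y. G y $ a $ b"] unfolding mdiff_def by blast
  then have GT: "mpd i (\<lambda>y. G (T y)) x = (\<Sum>m\<in>UNIV. J x $ m $ i *\<^sub>R mpd m G (T x))"
    by (simp add: vec_eq_iff mpd_def J)
  have "mpd i g x = mpd i (\<lambda>y. transpose (J y) ** G (T y) ** J y) x"
    by (rule mpd_cong [OF S x g])
  also have "\<dots> = transpose (mpd i J x) ** G (T x) ** J x
      + transpose (J x) ** mpd i (\<lambda>y. G (T y)) x ** J x + transpose (J x) ** G (T x) ** mpd i J x"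
    using Jd GTd by (simp add: mpd_mult mpd_transpose mdiff_mult mdiff_transpose
        matrix_add_rdistrib matrix_mul_assoc)
  finally have "gam g i x = trace (matrix_inv (J x) ** mpd i J x)
      + 1/2 * trace (matrix_inv (G (T x)) ** mpd i (\<lambda>y. G (T y)) x)"
    unfolding gam_def by (simp only:) (simp add: trace_pullback [OF G(2) g [OF x] d])
  also have "trace (matrix_inv (G (T x)) ** mpd i (\<lambda>y. G (T y)) x) =
      (\<Sum>m\<in>UNIV. J x $ m $ i * trace (matrix_inv (G (T x)) ** mpd m G (T x)))"
    unfolding GT by (simp add: trace_mult_sum)
  finally show ?thesis
    by (simp add: gam_def sum_distrib_left mult.left_commute)
qed

subsection \<open>The divergence and its formal derivative\<close>

lemma jac_nth:
  fixes T :: "real^'n::finite \<Rightarrow> real^'n"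
  assumes "\<And>m. (\<lambda>y. T y $ m) differentiable (at x)"
  shows "jac T x $ k $ r = pd r (\<lambda>y. T y $ k) x"
proof -
  let ?T' = "\<lambda>h. \<chi> m. frechet_derivative (\<lambda>y. T y $ m) (at x) h"
  have "(T has_derivative ?T') (at x)"
    unfolding has_derivative_componentwise_within [of T]
    using assms by (auto simp: Basis_vec_def inner_axis frechet_derivative_works [symmetric])
  then have "frechet_derivative T (at x) = ?T'"
    by (rule frechet_derivative_at [symmetric])
  then show ?thesis
    by (simp add: jac_def matrix_def pd_def)
qed

definition divergence :: "(real^'n::finite \<Rightarrow> real^'n^'n) \<Rightarrow> (real^'n \<Rightarrow> real^'n) \<Rightarrow> real^'n \<Rightarrow> real" where
  "divergence g v x = (\<Sum>r\<in>UNIV. pd r (\<lambda>y. v y $ r) x + gam g r x * v x $ r)"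

text \<open>The formal derivative of the divergence; equal to \<open>n A\<^sub>i\<close> on the conformal Killing system.\<close>

definition div_form :: "(real^'n::finite \<Rightarrow> real^'n^'n) \<Rightarrow> real^'n \<Rightarrow> 'n \<Rightarrow> 'n jet \<Rightarrow> real" where
  "div_form g x i \<xi> =
     (\<Sum>r\<in>UNIV. \<xi> r {#r, i#} + gam g r x * \<xi> r {#i#} + \<xi> r {#} * pd r (gam g i) x)"

lemma smooth_map_on_pd_differentiable:
  "smooth_map_on S v \<Longrightarrow> x \<in> S \<Longrightarrow> pd r (\<lambda>y. v y $ k) differentiable (at x)"
  unfolding smooth_map_on_def by (blast intro: smooth_on_differentiable smooth_on_pd)

lemma smooth_map_on_differentiable:
  "smooth_map_on S v \<Longrightarrow> x \<in> S \<Longrightarrow> (\<lambda>y. v y $ k) differentiable (at x)"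
  unfolding smooth_map_on_def by (blast intro: smooth_on_differentiable)

context
  fixes g :: "real^'n::finite \<Rightarrow> real^'n^'n" and S N and x :: "real^'n" and v :: "real^'n \<Rightarrow> real^'n"
  assumes S: "open S" and g: "smooth_matrix_on S g" "\<forall>x\<in>S. det (g x) \<noteq> 0" and x: "x \<in> S"
    and v: "smooth_map_on N v" and xN: "x \<in> N"
begin

lemma differentiable_divergence: "divergence g v differentiable (at x)"
proof -
  have d: "gam g r differentiable (at x)" for r
    by (rule smooth_on_differentiable [OF smooth_on_gam [OF S g] x])
  show ?thesis
    using smooth_map_on_pd_differentiable [OF v xN] smooth_map_on_differentiable [OF v xN] d
    unfolding divergence_def [abs_def]
    by (intro differentiable_sum differentiable_add differentiable_mult) auto
qed

text \<open>On the jet of an actual vector field the covector is the differential of a function;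
  this is the link through which its transition law is proved.\<close>

lemma pd_divergence:
  assumes \<xi>: "is_jet 2 v x \<xi>"
  shows "pd i (divergence g v) x = div_form g x i \<xi>"
proof -
  have d: "gam g r differentiable (at x)" for r
    by (rule smooth_on_differentiable [OF smooth_on_gam [OF S g] x])
  have j: "\<xi> k {#} = v x $ k" "\<xi> k {#a#} = pd a (\<lambda>y. v y $ k) x"
    "\<xi> k {#b, a#} = pd a (pd b (\<lambda>y. v y $ k)) x" for k a b
  proof -
    have *: "\<xi> k (mset is) = pds is (\<lambda>y. v y $ k) x" if "length is \<le> 2" for "is"
      using \<xi> that unfolding is_jet_def by blast
    show "\<xi> k {#} = v x $ k" "\<xi> k {#a#} = pd a (\<lambda>y. v y $ k) x"
      "\<xi> k {#b, a#} = pd a (pd b (\<lambda>y. v y $ k)) x"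
      using * [of "[]"] * [of "[a]"] * [of "[a, b]"] by (simp_all add: add_mset_commute)
  qed
  note dv = smooth_map_on_pd_differentiable [OF v xN] smooth_map_on_differentiable [OF v xN]
  have "pd i (divergence g v) x = (\<Sum>r\<in>UNIV. pd i (pd r (\<lambda>y. v y $ r)) x
      + (pd i (gam g r) x * v x $ r + gam g r x * pd i (\<lambda>y. v y $ r) x))"
    using dv d by (simp add: divergence_def [abs_def] pd_sum pd_add pd_mult differentiable_add
        differentiable_mult)
  also have "\<dots> = div_form g x i \<xi>"
    \<comment> \<open>Closedness replaces \<open>pd i (gam g r)\<close> by
      \<open>pd r (gam g i)\<close>, the form in which the coefficient occurs in
      \<open>div_form\<close>.\<close>
    unfolding div_form_def j gam_closed [OF S g x, of i] by (intro sum.cong) auto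
  finally show ?thesis .
qed

end

text \<open>Differentiating \<open>w (T z) = J z *v v z\<close> gives
  \<open>W ** J = (\<Sum>r. v\<^sup>r \<partial>\<^sub>r J) + J ** V\<close>. After multiplication
  by the inverse of \<open>J\<close> the trace shows that \<open>trace W\<close> exceeds
  \<open>trace V\<close> by exactly the contribution of the inhomogeneous term of
  \<open>gam\<close>.\<close>

lemma divergence_invariant:
  fixes T v w :: "real^'n::finite \<Rightarrow> real^'n"
  assumes S: "open S" and T: "smooth_map_on S T"
    and N: "open N" "N \<subseteq> S" and y: "y \<in> N" and v: "smooth_map_on N v"
    and w: "\<And>k. (\<lambda>z. w z $ k) differentiable (at (T y))"
    and J: "J = (\<lambda>y. \<chi> k r. pd r (\<lambda>z. T z $ k) y)" and dJ: "det (J y) \<noteq> 0"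
    and vw: "\<And>z. z \<in> N \<Longrightarrow> w (T z) = J z *v v z"
    and gam: "\<And>i. gam g i y = trace (matrix_inv (J y) ** mpd i J y)
        + (\<Sum>m\<in>UNIV. J y $ m $ i * gam G m (T y))"
  shows "divergence g v y = divergence G w (T y)"
proof -
  let ?K = "matrix_inv (J y)"
  define W where "W = (\<chi> k m. pd m (\<lambda>z. w z $ k) (T y))"
  define V where "V = (\<chi> r i. pd i (\<lambda>z. v z $ r) y)"
  have yS: "y \<in> S" using y N by auto
  have Td: "(\<lambda>z. T z $ m) differentiable (at y)" for m
    using smooth_map_on_differentiable [OF T yS] .
  have Jd: "(\<lambda>z. J z $ k $ r) differentiable (at y)" for k r
    using smooth_map_on_pd_differentiable [OF T yS] by (simp add: J)
  have vd: "(\<lambda>z. v z $ r) differentiable (at y)" for r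
    using smooth_map_on_differentiable [OF v y] .
  \<comment> \<open>The product rule yields
    \<open>\<partial>\<^sub>i J\<^sup>k\<^sub>r v\<^sup>r\<close>; exchanging \<open>i\<close> and
    \<open>r\<close> turns it into a combination of the matrices
    \<open>\<partial>\<^sub>r J\<close>, to which the trace can be applied.\<close>
  have sym: "mpd i J y $ k $ r = mpd r J y $ k $ i" for i k r
    using pd_commute [OF S _ yS, of "\<lambda>z. T z $ k"] T by (simp add: mpd_def J smooth_map_on_def)
  have "W ** J y = (\<Sum>r\<in>UNIV. v y $ r *\<^sub>R mpd r J y) + J y ** V"
  proof -
    have "(W ** J y) $ k $ i = ((\<Sum>r\<in>UNIV. v y $ r *\<^sub>R mpd r J y) + J y ** V) $ k $ i" for k i
    proof -
      have "(W ** J y) $ k $ i = pd i (\<lambda>z. w (T z) $ k) y"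
        using pd_compose(2) [of T y "\<lambda>z. w z $ k" i] Td w
        by (simp add: W_def J matrix_matrix_mult_def mult.commute)
      also have "\<dots> = pd i (\<lambda>z. \<Sum>r\<in>UNIV. J z $ k $ r * v z $ r) y"
        by (rule pd_cong [OF N(1) y]) (simp add: vw matrix_vector_mult_def)
      also have "\<dots> = (\<Sum>r\<in>UNIV. mpd i J y $ k $ r * v y $ r + J y $ k $ r * V $ r $ i)"
        using Jd vd by (simp add: pd_sum pd_mult differentiable_mult mpd_def V_def)
      finally show ?thesis
        by (simp add: sym [of i] sum.distrib matrix_matrix_mult_def mult.commute)
    qed
    then show ?thesis
      by (simp add: vec_eq_iff)
  qed
  then have "trace (?K ** (W ** J y)) =
      (\<Sum>r\<in>UNIV. v y $ r * trace (?K ** mpd r J y)) + trace (?K ** (J y ** V))"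
    by (simp add: matrix_add_ldistrib trace_add trace_mult_sum)
  moreover have "trace (?K ** (W ** J y)) = trace W"
    using trace_mul_sym [of ?K "W ** J y"] matrix_inv_right [OF dJ]
    by (simp add: matrix_mul_assoc [symmetric])
  moreover have "?K ** (J y ** V) = V"
    using matrix_inv_left [OF dJ] by (simp add: matrix_mul_assoc)
  ultimately have tr: "trace W = (\<Sum>r\<in>UNIV. v y $ r * trace (?K ** mpd r J y)) + trace V"
    by simp
  have "(\<Sum>m\<in>UNIV. gam G m (T y) * w (T y) $ m)
      = (\<Sum>r\<in>UNIV. v y $ r * (\<Sum>m\<in>UNIV. J y $ m $ r * gam G m (T y)))"
    unfolding vw [OF y] matrix_vector_mult_def
    by (simp add: sum_distrib_left mult_ac) (rule sum.swap)
  then have "divergence G w (T y) = trace W + (\<Sum>r\<in>UNIV. v y $ r * (\<Sum>m\<in>UNIV. J y $ m $ r * gam G m (T y)))"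
    by (simp add: divergence_def sum.distrib trace_def W_def)
  also have "\<dots> = divergence g v y"
    unfolding tr divergence_def gam
    by (simp add: trace_def V_def sum.distrib algebra_simps)
  finally show ?thesis by simp
qed

text \<open>The two vector fields supplied by \<open>same_jet\<close> correspond on a whole
  neighbourhood, so the equality of their divergences may be differentiated at \<open>x\<close>; the
  chain rule then produces the Jacobian.\<close>

lemma div_form_same_jet:
  fixes T :: "real^'n::finite \<Rightarrow> real^'n"
  assumes S: "open S" and T: "smooth_map_on S T"
    and g: "smooth_matrix_on S g" "\<forall>x\<in>S. det (g x) \<noteq> 0"
    and S': "open S'" "\<forall>x\<in>S. T x \<in> S'"
    and G: "smooth_matrix_on S' G" "\<forall>x\<in>S'. det (G x) \<noteq> 0" "\<forall>x\<in>S'. transpose (G x) = G x"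
    and gG: "\<forall>x\<in>S. g x = transpose (jac T x) ** G (T x) ** jac T x"
    and x: "x \<in> S" and jet: "same_jet 2 S T x \<xi> \<xi>'"
  shows "div_form g x i \<xi> = (\<Sum>m\<in>UNIV. jac T x $ m $ i * div_form G (T x) m \<xi>')"
proof -
  define J where "J = (\<lambda>y. \<chi> k r. pd r (\<lambda>z. T z $ k) y)"
  obtain N v w where N: "open N" "x \<in> N" "N \<subseteq> S" and v: "smooth_map_on N v"
    and w: "smooth_map_on (T ` N) w" and vw: "\<forall>y\<in>N. w (T y) = jac T y *v v y"
    and jets: "is_jet 2 v x \<xi>" "is_jet 2 w (T x) \<xi>'"
    using jet unfolding same_jet_def by blast
  have J: "jac T y = J y" if "y \<in> S" for y
    using smooth_map_on_differentiable [OF T that] by (simp add: vec_eq_iff J_def jac_nth)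
  have gJ: "g y = transpose (J y) ** G (T y) ** J y" if "y \<in> S" for y
    using gG that by (simp add: J)
  have Tx: "T x \<in> S'" using S' x by auto
  have inv: "divergence g v y = divergence G w (T y)" if y: "y \<in> N" for y
  proof (rule divergence_invariant [OF S T N(1,3) y v _ J_def])
    have yS: "y \<in> S" using y N by auto
    show "(\<lambda>z. w z $ k) differentiable (at (T y))" for k
      using smooth_map_on_differentiable [OF w] y by blast
    have "det (g y) \<noteq> 0" using g yS by auto
    then show "det (J y) \<noteq> 0"
      by (auto simp: gJ [OF yS] det_mul)
    show "w (T z) = J z *v v z" if "z \<in> N" for z
      using vw that J N by auto
    show "gam g i y = trace (matrix_inv (J y) ** mpd i J y)
        + (\<Sum>m\<in>UNIV. J y $ m $ i * gam G m (T y))" for i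
    proof (rule gam_pullback [OF S yS T J_def])
      show "mdiff G (T y)" "transpose (G (T y)) = G (T y)"
        using smooth_matrix_on_mdiff [OF G(1)] S' G yS by auto
    qed (use gJ \<open>det (g y) \<noteq> 0\<close> in auto)
  qed
  have TN: "T x \<in> T ` N" using N by auto
  have "div_form g x i \<xi> = pd i (divergence g v) x"
    using pd_divergence [OF S g x v N(2) jets(1)] by simp
  also have "\<dots> = pd i (\<lambda>y. divergence G w (T y)) x"
    by (rule pd_cong [OF N(1,2) inv])
  also have "\<dots> = (\<Sum>m\<in>UNIV. pd i (\<lambda>y. T y $ m) x * pd m (divergence G w) (T x))"
    using smooth_map_on_differentiable [OF T x] differentiable_divergence [OF S'(1) G(1,2) Tx w TN]
    by (rule pd_compose)
  also have "\<dots> = (\<Sum>m\<in>UNIV. jac T x $ m $ i * div_form G (T x) m \<xi>')"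
    using pd_divergence [OF S'(1) G(1,2) Tx w TN jets(2)] J [OF x] by (simp add: J_def)
  finally show ?thesis .
qed

subsection \<open>Skew-symmetric components\<close>

lemma length_del_nth [simp]: "s < length I \<Longrightarrow> length (del_nth s I) = length I - 1"
  by (simp add: del_nth_def)

lemma nth_del_nth:
  "s < length I \<Longrightarrow> t < length I - 1 \<Longrightarrow> del_nth s I ! t = I ! (if t < s then t else Suc t)"
  by (auto simp: del_nth_def nth_append)

definition swap_nth :: "nat \<Rightarrow> nat \<Rightarrow> 'b list \<Rightarrow> 'b list" where
  "swap_nth p q I = I[p := I ! q, q := I ! p]"

lemma length_swap_nth [simp]: "length (swap_nth p q I) = length I"
  by (simp add: swap_nth_def)

lemma nth_swap_nth:
  "p < length I \<Longrightarrow> q < length I \<Longrightarrow>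
    swap_nth p q I ! t = (if t = p then I ! q else if t = q then I ! p else I ! t)"
  by (auto simp: swap_nth_def nth_list_update)

lemma form_fibre_swapD:
  "\<alpha> \<in> form_fibre r \<Longrightarrow> p < q \<Longrightarrow> q < length I \<Longrightarrow> \<alpha> (swap_nth p q I) = - \<alpha> I"
  by (simp add: form_fibre_def swap_nth_def)

lemma form_fibre_lengthD: "\<alpha> \<in> form_fibre r \<Longrightarrow> length I \<noteq> r \<Longrightarrow> \<alpha> I = 0"
  by (simp add: form_fibre_def)

text \<open>A transposition of distant positions is an adjacent one conjugating a transposition of
  smaller distance: three sign changes in all.\<close>

lemma form_fibre_adjacentI:
  assumes len: "\<And>I. length I \<noteq> r \<Longrightarrow> \<alpha> I = 0"
    and adj: "\<And>I p. Suc p < length I \<Longrightarrow> \<alpha> (swap_nth p (Suc p) I) = - \<alpha> I"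
  shows "\<alpha> \<in> form_fibre r"
proof -
  have "\<alpha> (swap_nth p (p + Suc d) I) = - \<alpha> I" if "p + Suc d < length I" for p d I
    using that
  proof (induction d arbitrary: I)
    case 0
    then show ?case using adj by simp
  next
    case (Suc d)
    let ?q = "p + Suc d"
    have "swap_nth p (Suc ?q) I = swap_nth ?q (Suc ?q) (swap_nth p ?q (swap_nth ?q (Suc ?q) I))"
      using Suc.prems by (intro nth_equalityI) (auto simp: nth_swap_nth)
    then show ?case
      using adj [of ?q] Suc by simp
  qed
  then have "\<alpha> (swap_nth p q I) = - \<alpha> I" if "p < q" "q < length I" for p q I
    using that by (metis less_iff_Suc_add add_Suc_right)
  then show ?thesis
    using len by (simp add: form_fibre_def swap_nth_def)
qed

text \<open>The form \<open>dx\<^sup>i \<and> \<phi> i\<close>, summed over \<open>i\<close>: moving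
  the index of \<open>dx\<^sup>i\<close> from position \<open>s\<close> to the front costs
  \<open>(-1) ^ s\<close>. Exterior derivative, Spencer operator and projection all have this
  shape.\<close>

definition wedge :: "('n \<Rightarrow> 'n list \<Rightarrow> real) \<Rightarrow> 'n list \<Rightarrow> real" where
  "wedge \<phi> I = (\<Sum>s<length I. (-1) ^ s * \<phi> (I ! s) (del_nth s I))"

text \<open>Under an adjacent swap the two terms at the swapped positions trade places with opposite
  signs; in every other term the pair survives the deletion and the skew-symmetry of
  \<open>\<phi>\<close> applies.\<close>

lemma wedge_in_form_fibre:
  assumes "\<And>i. \<phi> i \<in> form_fibre r"
  shows "wedge \<phi> \<in> form_fibre (Suc r)"
proof (rule form_fibre_adjacentI)
  fix I :: "'a list" assume "length I \<noteq> Suc r"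
  then have "\<phi> (I ! s) (del_nth s I) = 0" if "s < length I" for s
    using that by (intro form_fibre_lengthD [OF assms]) auto
  then show "wedge \<phi> I = 0"
    by (simp add: wedge_def)
next
  fix I :: "'a list" and p assume p: "Suc p < length I"
  let ?I = "swap_nth p (Suc p) I" and ?\<tau> = "Transposition.transpose p (Suc p)"
  have "(-1) ^ s * \<phi> (?I ! s) (del_nth s ?I) = - ((-1) ^ ?\<tau> s * \<phi> (I ! ?\<tau> s) (del_nth (?\<tau> s) I))"
    if s: "s < length I" for s
  proof -
    consider "s = p" | "s = Suc p" | "s < p" | "Suc p < s" by linarith
    then show ?thesis
    proof cases
      case 1
      moreover have "del_nth p ?I = del_nth (Suc p) I"
        using p by (intro nth_equalityI) (auto simp: nth_del_nth nth_swap_nth)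
      ultimately show ?thesis
        using p by (simp add: nth_swap_nth)
    next
      case 2
      moreover have "del_nth (Suc p) ?I = del_nth p I"
        using p by (intro nth_equalityI) (auto simp: nth_del_nth nth_swap_nth)
      ultimately show ?thesis
        using p by (simp add: nth_swap_nth)
    next
      case 3
      \<comment> \<open>Deleting an entry to the left of the pair moves the pair one place
        down.\<close>
      then have "del_nth s ?I = swap_nth (p - 1) (Suc (p - 1)) (del_nth s I)"
        using p by (intro nth_equalityI) (auto simp: nth_del_nth nth_swap_nth)
      moreover have "\<phi> (I ! s) (swap_nth (p - 1) (Suc (p - 1)) (del_nth s I)) = - \<phi> (I ! s) (del_nth s I)"
        using p 3 by (intro form_fibre_swapD [OF assms]) auto
      ultimately show ?thesis
        using p 3 by (simp add: nth_swap_nth Transposition.transpose_def)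
    next
      case 4
      then have "del_nth s ?I = swap_nth p (Suc p) (del_nth s I)"
        using p s by (intro nth_equalityI) (auto simp: nth_del_nth nth_swap_nth)
      moreover have "\<phi> (I ! s) (swap_nth p (Suc p) (del_nth s I)) = - \<phi> (I ! s) (del_nth s I)"
        using p s 4 by (intro form_fibre_swapD [OF assms]) auto
      ultimately show ?thesis
        using p 4 by (simp add: nth_swap_nth Transposition.transpose_def)
    qed
  qed
  then have "wedge \<phi> ?I = - (\<Sum>s<length I. (-1) ^ ?\<tau> s * \<phi> (I ! ?\<tau> s) (del_nth (?\<tau> s) I))"
    by (simp add: wedge_def sum_negf)
  also have "bij_betw ?\<tau> {..<length I} {..<length I}"
    using p by (intro bij_betw_byWitness [where f' = ?\<tau>]) (auto simp: Transposition.transpose_def)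
  then have "(\<Sum>s<length I. (-1) ^ ?\<tau> s * \<phi> (I ! ?\<tau> s) (del_nth (?\<tau> s) I)) = wedge \<phi> I"
    unfolding wedge_def by (rule sum.reindex_bij_betw)
  finally show "wedge \<phi> ?I = - wedge \<phi> I" .
qed

lemma del_nth_del_nth:
  assumes "t < s" "s < length I"
  shows "del_nth t (del_nth s I) = del_nth (s - 1) (del_nth t I)"
  using assms by (intro nth_equalityI) (auto simp: nth_del_nth)

text \<open>This is \<open>dx\<^sup>i \<and> dx\<^sup>j = - dx\<^sup>j \<and> dx\<^sup>i\<close>:
  two positions deleted in either order leave the same list, with sign exponents differing by one.
  It is what kills symmetric terms.\<close>

lemma wedge_wedge_swap:
  "wedge (\<lambda>i. wedge (\<lambda>j. F i j)) I = - wedge (\<lambda>i. wedge (\<lambda>j. F j i)) I"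
proof -
  let ?n = "length I"
  define f where "f F = (\<lambda>(s, t). (-1) ^ (s + t) *
    F (I ! s) (del_nth s I ! t) (del_nth t (del_nth s I)))" for F :: "'a \<Rightarrow> 'a \<Rightarrow> 'a list \<Rightarrow> real"
  have ww: "wedge (\<lambda>i. wedge (\<lambda>j. F i j)) I = (\<Sum>st\<in>{..<?n} \<times> {..<?n - 1}. f F st)" for F
    by (simp add: wedge_def f_def sum.cartesian_product [symmetric] sum_distrib_left power_add mult.assoc)
  \<comment> \<open>The second position is counted in the shortened list, so reversing the order of
    deletion shifts it by one on one side of the first position.\<close>
  let ?\<sigma> = "\<lambda>(s, t). if t < s then (t, s - 1) else (Suc t, s)"
  have "(\<Sum>st\<in>{..<?n} \<times> {..<?n - 1}. f F st) = (\<Sum>st\<in>{..<?n} \<times> {..<?n - 1}. - f (\<lambda>i j. F j i) st)"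
  proof (rule sum.reindex_bij_witness [of _ ?\<sigma> ?\<sigma>])
    fix st assume "st \<in> {..<?n} \<times> {..<?n - 1}"
    then obtain s t where st: "st = (s, t)" "s < ?n" "t < ?n - 1" by auto
    show "- f (\<lambda>i j. F j i) (?\<sigma> st) = f F st"
    proof (cases "t < s")
      case True
      then obtain s' where "s = Suc s'" by (cases s) auto
      then show ?thesis
        using st True del_nth_del_nth [of t s I] by (simp add: f_def nth_del_nth add.commute)
    next
      case False
      then show ?thesis
        using st del_nth_del_nth [of s "Suc t" I] by (simp add: f_def nth_del_nth add.commute)
    qed
  qed (auto split: if_splits)
  then show ?thesis
    by (simp add: ww sum_negf)
qed

text \<open>Moving entry \<open>s\<close> of \<open>I\<close> to the front changes a skew-symmetric
  component by \<open>(-1) ^ s\<close>, which cancels the sign in \<open>wedge\<close>; the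
  \<open>r\<close> positions contribute equally. Splitting off an index is therefore, up to a
  factor, a right inverse of \<open>wedge\<close>.\<close>

lemma wedge_cons:
  assumes "\<beta> \<in> form_fibre r"
  shows "wedge (\<lambda>i I. \<beta> (i # I)) I = real r * \<beta> I"
proof -
  have *: "\<beta> (I ! s # del_nth s I) = (-1) ^ s * \<beta> I" if "s < length I" for s
    using that
  proof (induction s arbitrary: I)
    case 0
    then show ?case by (cases I) (auto simp: del_nth_def)
  next
    case (Suc s)
    have "del_nth s (swap_nth s (Suc s) I) = del_nth (Suc s) I"
      using Suc.prems by (intro nth_equalityI) (auto simp: nth_del_nth nth_swap_nth)
    then show ?case
      using Suc.IH [of "swap_nth s (Suc s) I"] Suc.prems form_fibre_swapD [OF assms, of s "Suc s" I]
      by (simp add: nth_swap_nth)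
  qed
  have "wedge (\<lambda>i I. \<beta> (i # I)) I = (\<Sum>s<length I. \<beta> I)"
    unfolding wedge_def by (rule sum.cong) (simp_all add: * mult.assoc [symmetric] power_add [symmetric])
  also have "\<dots> = real r * \<beta> I"
    using form_fibre_lengthD [OF assms, of I] by (cases "length I = r") auto
  finally show ?thesis .
qed

lemma form_fibre_cons:
  assumes "\<beta> \<in> form_fibre (Suc r)"
  shows "(\<lambda>I. \<beta> (i # I)) \<in> form_fibre r"
proof (rule form_fibre_adjacentI)
  show "\<beta> (i # I) = 0" if "length I \<noteq> r" for I
    using that by (intro form_fibre_lengthD [OF assms]) simp
  show "\<beta> (i # swap_nth p (Suc p) I) = - \<beta> (i # I)" if "Suc p < length I" for I p
    using form_fibre_swapD [OF assms, of "Suc p" "Suc (Suc p)" "i # I"] that by (simp add: swap_nth_def)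
qed

lemma prod_lessThan_delete:
  fixes h :: "nat \<Rightarrow> real"
  assumes "s < Suc n"
  shows "(\<Prod>u<Suc n. h u) = h s * (\<Prod>u<n. h (if u < s then u else Suc u))"
proof -
  have "(\<Prod>u<n. h (if u < s then u else Suc u)) = (\<Prod>u\<in>{..<Suc n} - {s}. h u)"
    using assms by (intro prod.reindex_bij_witness
        [of _ "\<lambda>u. if u < s then u else u - 1" "\<lambda>u. if u < s then u else Suc u"]) (auto split: if_splits)
  then show ?thesis
    using prod.remove [of "{..<Suc n}" s h] assms by (simp del: prod.lessThan_Suc)
qed

text \<open>The sum over lists of length \<open>n + 1\<close> is split into the entry
  \<open>m\<close> at position \<open>s\<close> and the remaining list of length \<open>n\<close>;
  the product of Jacobian entries splits accordingly.\<close>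

lemma pull_form_wedge:
  "pull_form J (wedge \<phi>) K = wedge (\<lambda>i I. \<Sum>m\<in>UNIV. J $ m $ i * pull_form J (\<phi> m) I) K"
proof (cases "length K")
  case 0
  then show ?thesis
    by (simp add: pull_form_def wedge_def)
next
  case (Suc n)
  have *: "(\<Sum>K' | length K' = Suc n. (\<Prod>u<Suc n. J $ (K' ! u) $ (K ! u)) * \<phi> (K' ! s) (del_nth s K'))
      = (\<Sum>m\<in>UNIV. J $ m $ (K ! s) * pull_form J (\<phi> m) (del_nth s K))" if s: "s < Suc n" for s
  proof -
    have "(\<Sum>K' | length K' = Suc n. (\<Prod>u<Suc n. J $ (K' ! u) $ (K ! u)) * \<phi> (K' ! s) (del_nth s K'))
        = (\<Sum>(m, I')\<in>UNIV \<times> {I'. length I' = n}. J $ m $ (K ! s) *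
            ((\<Prod>u<n. J $ (I' ! u) $ (del_nth s K ! u)) * \<phi> m I'))"
    proof (rule sum.reindex_bij_witness [of _ "\<lambda>(m, I'). take s I' @ m # drop s I'"
          "\<lambda>K'. (K' ! s, del_nth s K')"], goal_cases)
      case (1 K')
      then show ?case using s id_take_nth_drop [of s K']
        by (simp add: del_nth_def min_def)
    next
      case (2 K')
      then show ?case using s by simp
    next
      case (3 mI)
      then show ?case using s
        by (auto simp: del_nth_def nth_append min_def)
    next
      case (4 mI)
      then show ?case using s by auto
    next
      case (5 K')
      have "(\<Prod>u<n. J $ (del_nth s K' ! u) $ (del_nth s K ! u))
          = (\<Prod>u<n. J $ (K' ! (if u < s then u else Suc u)) $ (K ! (if u < s then u else Suc u)))"
        using s 5 Suc by (intro prod.cong) (simp_all add: nth_del_nth)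
      then show ?case
        using prod_lessThan_delete [OF s, of "\<lambda>u. J $ (K' ! u) $ (K ! u)"] by simp
    qed
    also have "\<dots> = (\<Sum>m\<in>UNIV. J $ m $ (K ! s) * pull_form J (\<phi> m) (del_nth s K))"
      using s Suc by (simp add: pull_form_def sum.cartesian_product [symmetric] sum_distrib_left)
    finally show ?thesis .
  qed
  have "pull_form J (wedge \<phi>) K = (\<Sum>K' | length K' = Suc n. \<Sum>s<Suc n. (-1) ^ s *
      ((\<Prod>u<Suc n. J $ (K' ! u) $ (K ! u)) * \<phi> (K' ! s) (del_nth s K')))"
    unfolding pull_form_def wedge_def Suc
    by (intro sum.cong) (auto simp: sum_distrib_left mult.left_commute simp del: sum.lessThan_Suc prod.lessThan_Suc)
  also have "\<dots> = (\<Sum>s<Suc n. (-1) ^ s * (\<Sum>K' | length K' = Suc n.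
      ((\<Prod>u<Suc n. J $ (K' ! u) $ (K ! u)) * \<phi> (K' ! s) (del_nth s K'))))"
    unfolding sum_distrib_left by (rule sum.swap)
  also have "\<dots> = wedge (\<lambda>i I. \<Sum>m\<in>UNIV. J $ m $ i * pull_form J (\<phi> m) I) K"
    unfolding wedge_def Suc by (intro sum.cong) (auto simp: * simp del: prod.lessThan_Suc)
  finally show ?thesis .
qed

subsection \<open>The first prolongation\<close>

lemma smooth_on_christoffel:
  assumes S: "open S" and g: "smooth_matrix_on S g" "\<forall>x\<in>S. det (g x) \<noteq> 0"
  shows "smooth_on S (christoffel g k i j)"
proof -
  have "smooth_matrix_on S (\<lambda>x. matrix_inv (g x))"
    using smooth_matrix_on_inv [OF S g] .
  then show ?thesis
    using g(1) unfolding christoffel_def [abs_def] smooth_matrix_on_def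
    by (intro smooth_on_intros [OF S] smooth_on_pd) auto
qed

lemma killing_eq1_cong:
  "(\<And>k \<mu>. size \<mu> \<le> 2 \<Longrightarrow> \<xi> k \<mu> = \<eta> k \<mu>) \<Longrightarrow> killing_eq1 g x \<xi> A i j = killing_eq1 g x \<eta> A i j"
  by (simp add: killing_eq1_def)

lemma killing_eq2_cong:
  "(\<And>k \<mu>. size \<mu> \<le> 2 \<Longrightarrow> \<xi> k \<mu> = \<eta> k \<mu>) \<Longrightarrow> killing_eq2 g x \<xi> a k i j = killing_eq2 g x \<eta> a k i j"
  by (simp add: killing_eq2_def)

text \<open>Joint linearity in the jet and the parameter lets a curve of jets be separated into
  solutions and an error term.\<close>

lemma killing_eq1_add:
  "killing_eq1 g x (\<lambda>k \<mu>. \<xi> k \<mu> + \<eta> k \<mu>) (A + B) i j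
    = killing_eq1 g x \<xi> A i j + killing_eq1 g x \<eta> B i j"
  by (simp add: killing_eq1_def algebra_simps sum.distrib)

lemma killing_eq2_add:
  "killing_eq2 g x (\<lambda>k \<mu>. \<xi> k \<mu> + \<eta> k \<mu>) (a + b) k i j
    = killing_eq2 g x \<xi> a k i j + killing_eq2 g x \<eta> b k i j"
  by (simp add: killing_eq2_def algebra_simps sum.distrib sum_subtractf)

lemma smooth_on_killing_eq1:
  assumes S: "open S" and g: "smooth_matrix_on S g"
    and \<xi>: "\<And>k \<mu>. smooth_on S (\<lambda>y. \<xi> y k \<mu>)" and A: "smooth_on S A"
  shows "smooth_on S (\<lambda>y. killing_eq1 g y (\<xi> y) (A y) i j)"
  unfolding killing_eq1_def using g
  by (intro smooth_on_intros [OF S] smooth_on_pd S \<xi> A) (auto simp: smooth_matrix_on_def)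

lemma smooth_on_killing_eq2:
  assumes S: "open S" and g: "smooth_matrix_on S g" "\<forall>x\<in>S. det (g x) \<noteq> 0"
    and \<xi>: "\<And>k \<mu>. smooth_on S (\<lambda>y. \<xi> y k \<mu>)" and a: "\<And>k. smooth_on S (\<lambda>y. a y $ k)"
  shows "smooth_on S (\<lambda>y. killing_eq2 g y (\<xi> y) (a y) k i j)"
proof -
  have "smooth_on S (\<lambda>y. g y $ i $ j)" "smooth_on S (\<lambda>y. matrix_inv (g y) $ i $ j)" for i j
    using g(1) smooth_matrix_on_inv [OF S g] by (simp_all add: smooth_matrix_on_def)
  then show ?thesis
    unfolding killing_eq2_def
    by (intro smooth_on_intros [OF S] smooth_on_pd S \<xi> a smooth_on_christoffel [OF S g])
qed

section \<open>Contractions that recover the parameters of the Killing system from the jet\<close>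

context
  fixes g :: "real^'n::finite \<Rightarrow> real^'n^'n" and x :: "real^'n"
  assumes g: "det (g x) \<noteq> 0" "transpose (g x) = g x"
begin

lemma metric_sym: "g x $ i $ j = g x $ j $ i"
  using arg_cong [OF g(2), of "\<lambda>M. M $ i $ j"] by (simp add: transpose_def)

lemma metric_inverse: "(\<Sum>r\<in>UNIV. g x $ r $ i * matrix_inv (g x) $ r $ s) = of_bool (i = s)"
proof -
  have "(\<Sum>r\<in>UNIV. g x $ r $ i * matrix_inv (g x) $ r $ s) = (g x ** matrix_inv (g x)) $ i $ s"
    by (simp add: matrix_matrix_mult_def metric_sym [of i])
  then show ?thesis
    by (simp add: matrix_inv_right [OF g(1)] mat_def)
qed

lemma metric_inverse_contract:
  "(\<Sum>r\<in>UNIV. g x $ r $ i * (\<Sum>s\<in>UNIV. matrix_inv (g x) $ r $ s * a $ s)) = a $ i"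
proof -
  have "(\<Sum>r\<in>UNIV. g x $ r $ i * (\<Sum>s\<in>UNIV. matrix_inv (g x) $ r $ s * a $ s))
      = (\<Sum>s\<in>UNIV. (\<Sum>r\<in>UNIV. g x $ r $ i * matrix_inv (g x) $ r $ s) * a $ s)"
    by (simp add: sum_distrib_left sum_distrib_right mult.assoc) (rule sum.swap)
  then show ?thesis
    by (simp add: metric_inverse)
qed

text \<open>The first Kronecker term contributes \<open>n\<close>, the second contributes 1, and the
  metric term takes that 1 back.\<close>

lemma conformal_trace:
  "(\<Sum>k\<in>UNIV. of_bool (k = k) * a $ i + of_bool (k = i) * a $ k
      - g x $ k $ i * (\<Sum>r\<in>UNIV. matrix_inv (g x) $ k $ r * a $ r)) = real CARD('n) * a $ i"
  by (simp add: sum.distrib sum_subtractf metric_inverse_contract)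

text \<open>With the parameter set to 0 the left-hand side of the equation remains, and contraction
  with the inverse metric solves for \<open>A\<close>. The formula makes \<open>A\<close> smooth
  along a smooth family of jets; \<open>killing_eq2_trace\<close> does the same for
  \<open>a\<close>.\<close>

lemma killing_eq1_trace:
  assumes "\<forall>i j. killing_eq1 g x \<xi> A i j = 0"
  shows "A = 1 / real CARD('n) *
    (\<Sum>i\<in>UNIV. \<Sum>j\<in>UNIV. matrix_inv (g x) $ i $ j * killing_eq1 g x \<xi> 0 i j)"
proof -
  have "killing_eq1 g x \<xi> 0 i j = A * g x $ i $ j" for i j
    using assms [rule_format, of i j] by (simp add: killing_eq1_def)
  then have "(\<Sum>i\<in>UNIV. \<Sum>j\<in>UNIV. matrix_inv (g x) $ i $ j * killing_eq1 g x \<xi> 0 i j)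
      = A * (\<Sum>j\<in>UNIV. \<Sum>i\<in>UNIV. g x $ i $ j * matrix_inv (g x) $ i $ j)"
    by (subst sum.swap) (simp add: sum_distrib_left mult_ac)
  then show ?thesis
    by (simp add: metric_inverse)
qed

lemma killing_eq2_trace:
  assumes "\<forall>i j k. killing_eq2 g x \<xi> a k i j = 0"
  shows "a $ i = 1 / real CARD('n) * (\<Sum>k\<in>UNIV. killing_eq2 g x \<xi> 0 k k i)"
proof -
  have "killing_eq2 g x \<xi> 0 k k i = of_bool (k = k) * a $ i + of_bool (k = i) * a $ k
      - g x $ k $ i * (\<Sum>r\<in>UNIV. matrix_inv (g x) $ k $ r * a $ r)" for k
    using assms [rule_format, of k k i] by (simp add: killing_eq2_def)
  then show ?thesis
    by (simp only: conformal_trace) simp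
qed

end

text \<open>Since \<open>u\<close> vanishes together with its derivative, the derivative of
  \<open>c\<close> drops out; no derivative of the metric coefficients along the line has to be
  computed.\<close>

lemma DERIV_mult_zero:
  fixes c u :: "real \<Rightarrow> real"
  assumes "c differentiable (at t)" "(u has_real_derivative 0) (at t)" "u t = 0"
  shows "((\<lambda>t. c t * u t) has_real_derivative 0) (at t)"
proof -
  obtain c' where "(c has_real_derivative c') (at t)"
    using assms(1) real_differentiable_def by blast
  from DERIV_mult [OF this assms(2)] show ?thesis
    using assms(3) by simp
qed

lemma DERIV_sum_zero:
  "(\<And>a. a \<in> A \<Longrightarrow> (f a has_real_derivative 0) (at t)) \<Longrightarrow>
    ((\<lambda>t. \<Sum>a\<in>A. f a t) has_real_derivative 0) (at t)"
  using DERIV_sum [of A "\<lambda>t a. f a t" "\<lambda>_. 0"] by simp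

lemma DERIV_add_zero:
  "(f has_real_derivative 0) (at t) \<Longrightarrow> (h has_real_derivative 0) (at t) \<Longrightarrow>
    ((\<lambda>s. f s + h s) has_real_derivative 0) (at t)"
  using DERIV_add [of f 0 t UNIV h 0] by simp

lemma DERIV_diff_zero:
  "(f has_real_derivative 0) (at t) \<Longrightarrow> (h has_real_derivative 0) (at t) \<Longrightarrow>
    ((\<lambda>s. f s - h s) has_real_derivative 0) (at t)"
  using DERIV_diff [of f 0 t UNIV h 0] by simp

lemmas DERIV_zero_intros = DERIV_sum_zero DERIV_add_zero DERIV_diff_zero DERIV_mult_zero

lemma differentiable_along_line:
  assumes "smooth_on S f" "x \<in> S"
  shows "(\<lambda>t. f (x + t *\<^sub>R axis l 1)) differentiable (at (0::real))"
    and "((\<lambda>t. f (x + t *\<^sub>R axis l 1)) has_real_derivative pd l f x) (at 0)"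
  using pd_line [of f x 0 l] smooth_on_differentiable [OF assms] real_differentiable_def by auto

text \<open>A curve of jets over a line which vanishes to first order at the base point contributes
  nothing to the formal derivative.\<close>

lemma killing_eq1_zero_derivative:
  assumes S: "open S" "x \<in> S" and g: "smooth_matrix_on S g"
    and \<xi>: "\<And>k \<mu>. size \<mu> \<le> 2 \<Longrightarrow> ((\<lambda>t. \<xi> t k \<mu>) has_real_derivative 0) (at 0)"
      "\<And>k \<mu>. size \<mu> \<le> 2 \<Longrightarrow> \<xi> 0 k \<mu> = 0"
    and A: "(A has_real_derivative 0) (at 0)" "A 0 = 0"
  shows "((\<lambda>t. killing_eq1 g (x + t *\<^sub>R axis l 1) (\<xi> t) (A t) i j) has_real_derivative 0) (at 0)"
proof -
  have d: "(\<lambda>t. g (x + t *\<^sub>R axis l 1) $ i $ j) differentiable (at (0::real))"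
    "(\<lambda>t. pd r (\<lambda>y. g y $ i $ j) (x + t *\<^sub>R axis l 1)) differentiable (at (0::real))" for i j r
    using differentiable_along_line(1) [of S "\<lambda>y. g y $ i $ j"]
      differentiable_along_line(1) [of S "pd r (\<lambda>y. g y $ i $ j)"] g S
    by (simp_all add: smooth_matrix_on_def smooth_on_pd)
  show ?thesis
    unfolding killing_eq1_def mult.commute [of "\<xi> _ _ {#}"] mult.commute [of "A _"]
    by (intro DERIV_zero_intros d) (auto intro: \<xi> A)
qed

lemma killing_eq2_zero_derivative:
  assumes S: "open S" "x \<in> S" and g: "smooth_matrix_on S g" "\<forall>x\<in>S. det (g x) \<noteq> 0"
    and \<xi>: "\<And>k \<mu>. size \<mu> \<le> 2 \<Longrightarrow> ((\<lambda>t. \<xi> t k \<mu>) has_real_derivative 0) (at 0)"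
      "\<And>k \<mu>. size \<mu> \<le> 2 \<Longrightarrow> \<xi> 0 k \<mu> = 0"
    and a: "\<And>r. ((\<lambda>t. a t $ r) has_real_derivative 0) (at 0)" "\<And>r. a 0 $ r = 0"
  shows "((\<lambda>t. killing_eq2 g (x + t *\<^sub>R axis l 1) (\<xi> t) (a t) k i j) has_real_derivative 0) (at 0)"
proof -
  note \<Gamma> = smooth_on_christoffel [OF S(1) g]
  have d: "(\<lambda>t. g (x + t *\<^sub>R axis l 1) $ i $ j) differentiable (at (0::real))"
    "(\<lambda>t. matrix_inv (g (x + t *\<^sub>R axis l 1)) $ i $ j) differentiable (at (0::real))"
    "(\<lambda>t. christoffel g k i j (x + t *\<^sub>R axis l 1)) differentiable (at (0::real))"
    "(\<lambda>t. pd r (christoffel g k i j) (x + t *\<^sub>R axis l 1)) differentiable (at (0::real))" for i j k r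
    using differentiable_along_line(1) [of S "\<lambda>y. g y $ i $ j"]
      differentiable_along_line(1) [of S "\<lambda>y. matrix_inv (g y) $ i $ j"]
      differentiable_along_line(1) [OF \<Gamma>] differentiable_along_line(1) [OF smooth_on_pd [OF \<Gamma>]]
      g(1) smooth_matrix_on_inv [OF S(1) g] S
    by (simp_all add: smooth_matrix_on_def)
  show ?thesis
    unfolding killing_eq2_def mult.commute [of "\<xi> _ _ {#}"]
    by (intro DERIV_zero_intros d) (auto intro: \<xi> a sum.neutral simp: a)
qed

text \<open>Along a line the jets of the solution satisfy the equations identically near the base
  point, whereas \<open>conf3\<close> asks for the derivative along the affine curve given by the
  3-jet. The two curves agree to first order, so the derivatives agree as well.\<close>

lemma ex_lift_to_conf3:
  fixes g :: "real^'n::finite \<Rightarrow> real^'n^'n"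
  assumes S: "open S" and g: "smooth_matrix_on S g" "\<forall>x\<in>S. det (g x) \<noteq> 0"
      "\<forall>x\<in>S. transpose (g x) = g x"
    and N: "open N" "x \<in> N" "N \<subseteq> S" and v: "smooth_map_on N v" and \<xi>: "is_jet 2 v x \<xi>"
    and sol: "\<forall>y\<in>N. \<exists>\<eta>\<in>conf2 g y. is_jet 2 v y \<eta>"
  shows "\<exists>\<zeta>. \<zeta> \<in> conf3 g x \<and> (\<forall>k \<mu>. size \<mu> \<le> 2 \<longrightarrow> \<zeta> k \<mu> = \<xi> k \<mu>)"
proof -
  have gN: "smooth_matrix_on N g" "\<forall>x\<in>N. det (g x) \<noteq> 0" "\<forall>x\<in>N. transpose (g x) = g x"
    using g N(3) smooth_on_subset unfolding smooth_matrix_on_def by blast+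
  have vs: "smooth_on N (\<lambda>z. v z $ k)" for k
    using v by (simp add: smooth_map_on_def)
  \<comment> \<open>An arbitrary enumeration of the multiset is used; by symmetry of the derivatives
    on \<open>N\<close>, \<open>jt_pds\<close> holds for every other one.\<close>
  define jt where "jt y k \<mu> = (if size \<mu> \<le> 3 then pds (SOME is. mset is = \<mu>) (\<lambda>z. v z $ k) y else 0)"
    for y k \<mu>
  have jt_pds: "jt y k (mset is) = pds is (\<lambda>z. v z $ k) y" if "length is \<le> 3" "y \<in> N" for y k "is"
  proof -
    have "mset (SOME js. mset js = mset is) = mset is"
      by (rule someI [where P = "\<lambda>js. mset js = mset is"]) (rule refl)
    then show ?thesis
      using pds_mset_cong [OF N(1) vs that(2), of "SOME js. mset js = mset is" "is"] that(1)
      by (simp add: jt_def)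
  qed
  have jt_smooth: "smooth_on N (\<lambda>y. jt y k \<mu>)" for k \<mu>
    unfolding jt_def using smooth_on_pds [OF vs] smooth_on_const [OF N(1)]
    by (cases "size \<mu> \<le> 3") simp_all
  have jt_pd: "pd l (\<lambda>y. jt y k \<mu>) x = jt x k (add_mset l \<mu>)" if "size \<mu> \<le> 2" for l k \<mu>
  proof -
    obtain "is" where isl: "mset is = \<mu>" using ex_mset by blast
    have len: "length is \<le> 2" using isl that by auto
    have "pd l (\<lambda>y. jt y k (mset is)) x = pd l (pds is (\<lambda>z. v z $ k)) x"
      by (rule pd_cong [OF N(1,2)]) (use jt_pds len in simp)
    also have "\<dots> = jt x k (mset (l # is))"
      using jt_pds [of "l # is"] len N(2) by simp
    finally show ?thesis by (simp add: isl)
  qed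
  have jet_jt: "\<eta> k \<mu> = jt y k \<mu>" if "is_jet 2 v y \<eta>" "y \<in> N" "size \<mu> \<le> 2" for y \<eta> k \<mu>
  proof -
    obtain "is" where isl: "mset is = \<mu>" using ex_mset by blast
    then show ?thesis
      using that jt_pds [of "is" y k] unfolding is_jet_def by fastforce
  qed
  \<comment> \<open>The trace formulas replace the parameters chosen separately at each
    point.\<close>
  define A where "A y = 1 / real CARD('n) *
    (\<Sum>i\<in>UNIV. \<Sum>j\<in>UNIV. matrix_inv (g y) $ i $ j * killing_eq1 g y (jt y) 0 i j)" for y
  define a where "a y = (\<chi> i. 1 / real CARD('n) * (\<Sum>k\<in>UNIV. killing_eq2 g y (jt y) 0 k k i))" for y
  have A_smooth: "smooth_on N A"
    unfolding A_def [abs_def] using smooth_matrix_on_inv [OF N(1) gN(1,2)]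
    by (intro smooth_on_intros [OF N(1)] smooth_on_pd N(1) smooth_on_killing_eq1 gN jt_smooth)
      (simp add: smooth_matrix_on_def)
  have a_smooth: "smooth_on N (\<lambda>y. a y $ k)" for k
    unfolding a_def vec_lambda_beta
    by (intro smooth_on_intros [OF N(1)] smooth_on_pd N(1) smooth_on_killing_eq2 gN jt_smooth)
  have eqs: "killing_eq1 g y (jt y) (A y) i j = 0" "killing_eq2 g y (jt y) (a y) k i j = 0"
    if y: "y \<in> N" for y i j k
  proof -
    obtain \<eta> B b where "is_jet 2 v y \<eta>" and *: "\<forall>i j. killing_eq1 g y \<eta> B i j = 0"
        "\<forall>i j k. killing_eq2 g y \<eta> b k i j = 0"
      using sol y unfolding conf2_def by blast
    then have \<eta>: "\<And>k \<mu>. size \<mu> \<le> 2 \<Longrightarrow> \<eta> k \<mu> = jt y k \<mu>"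
      using jet_jt y by blast
    have **: "\<forall>i j. killing_eq1 g y (jt y) B i j = 0" "\<forall>i j k. killing_eq2 g y (jt y) b k i j = 0"
      using * killing_eq1_cong [of \<eta> "jt y"] killing_eq2_cong [of \<eta> "jt y"] \<eta> by metis+
    have "B = A y" "b = a y"
      using killing_eq1_trace [OF _ _ **(1)] killing_eq2_trace [OF _ _ **(2)] gN y
      by (auto simp: A_def a_def vec_eq_iff)
    then show "killing_eq1 g y (jt y) (A y) i j = 0" "killing_eq2 g y (jt y) (a y) k i j = 0"
      using ** by auto
  qed
  let ?p = "\<lambda>l t. x + t *\<^sub>R axis l (1::real)"
  have zero: "(f has_real_derivative 0) (at 0)" if "\<And>t. ?p l t \<in> N \<Longrightarrow> f t = 0" for f l
  proof -
    have "open (?p l -` N)"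
      by (intro open_vimage N(1) continuous_intros)
    then show ?thesis
      by (rule has_field_derivative_transform_within_open [OF DERIV_const [of 0]])
        (use N(2) that in auto)
  qed
  define a' where "a' l = (\<chi> k. pd l (\<lambda>y. a y $ k) x)" for l
  \<comment> \<open>The affine curve minus the curve of actual jets. The third order components make
    its derivative at 0 vanish, by \<open>jt_pd\<close>.\<close>
  define \<delta> where "\<delta> l t k \<mu> = jt x k \<mu> + t * jt x k (add_mset l \<mu>) - jt (?p l t) k \<mu>" for l t k \<mu>
  have \<delta>: "((\<lambda>t. \<delta> l t k \<mu>) has_real_derivative 0) (at 0)" "\<delta> l 0 k \<mu> = 0" if "size \<mu> \<le> 2" for l k \<mu>
    unfolding \<delta>_def using differentiable_along_line(2) [OF jt_smooth [of k \<mu>] N(2), of l] jt_pd [OF that]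
    by (auto intro!: derivative_eq_intros)
  have "((\<lambda>t. killing_eq1 g (?p l t) (\<lambda>k \<mu>. jt x k \<mu> + t * jt x k (add_mset l \<mu>))
      (A x + t * pd l A x) i j) has_real_derivative 0) (at 0)" for i j l
  proof -
    have "((\<lambda>t. killing_eq1 g (?p l t) (jt (?p l t)) (A (?p l t)) i j
        + killing_eq1 g (?p l t) (\<delta> l t) (A x + t * pd l A x - A (?p l t)) i j)
        has_real_derivative 0) (at 0)"
    proof (rule DERIV_add_zero)
      show "((\<lambda>t. killing_eq1 g (?p l t) (jt (?p l t)) (A (?p l t)) i j) has_real_derivative 0) (at 0)"
        by (rule zero) (rule eqs)
      have "((\<lambda>t. A x + t * pd l A x - A (?p l t)) has_real_derivative 0) (at 0)"
        using differentiable_along_line(2) [OF A_smooth N(2), of l] by (auto intro!: derivative_eq_intros)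
      then show "((\<lambda>t. killing_eq1 g (?p l t) (\<delta> l t) (A x + t * pd l A x - A (?p l t)) i j)
          has_real_derivative 0) (at 0)"
        by (intro killing_eq1_zero_derivative [OF N(1,2) gN(1)] \<delta>) auto
    qed
    then show ?thesis
      unfolding killing_eq1_add [symmetric] \<delta>_def by simp
  qed
  moreover have "((\<lambda>t. killing_eq2 g (?p l t) (\<lambda>k \<mu>. jt x k \<mu> + t * jt x k (add_mset l \<mu>))
      (a x + t *\<^sub>R a' l) k i j) has_real_derivative 0) (at 0)" for i j k l
  proof -
    have "((\<lambda>t. killing_eq2 g (?p l t) (jt (?p l t)) (a (?p l t)) k i j
        + killing_eq2 g (?p l t) (\<delta> l t) (a x + t *\<^sub>R a' l - a (?p l t)) k i j)
        has_real_derivative 0) (at 0)"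
    proof (rule DERIV_add_zero)
      show "((\<lambda>t. killing_eq2 g (?p l t) (jt (?p l t)) (a (?p l t)) k i j) has_real_derivative 0) (at 0)"
        by (rule zero) (rule eqs)
      have "((\<lambda>t. (a x + t *\<^sub>R a' l - a (?p l t)) $ r) has_real_derivative 0) (at 0)" for r
        using differentiable_along_line(2) [OF a_smooth [of r] N(2), of l]
        by (auto intro!: derivative_eq_intros simp: a'_def)
      then show "((\<lambda>t. killing_eq2 g (?p l t) (\<delta> l t) (a x + t *\<^sub>R a' l - a (?p l t)) k i j)
          has_real_derivative 0) (at 0)"
        by (intro killing_eq2_zero_derivative [OF N(1,2) gN(1,2)] \<delta>) auto
    qed
    then show ?thesis
      unfolding killing_eq2_add [symmetric] \<delta>_def by simp
  qed
  moreover have "jt x \<in> jets 3"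
    by (simp add: jets_def jt_def)
  ultimately have "jt x \<in> conf3 g x"
    unfolding conf3_def using eqs [OF N(2)]
    by (intro CollectI conjI exI [of _ "A x"] exI [of _ "a x"] exI [of _ "\<lambda>l. pd l A x"]
        exI [of _ a'] allI) auto
  then show ?thesis
    using jet_jt [OF \<xi> N(2)] by (intro exI [of _ "jt x"]) auto
qed

subsection \<open>The projection\<close>

text \<open>The second order components that the second Killing equation prescribes for a jet with
  vanishing components of order 0 and 1.\<close>

definition conformal_symbol ::
    "(real^'n \<Rightarrow> real^'n^'n) \<Rightarrow> real^'n \<Rightarrow> ('n::finite \<Rightarrow> real) \<Rightarrow>
      'n \<Rightarrow> 'n \<Rightarrow> 'n \<Rightarrow> real" where
  "conformal_symbol g x a k i j = of_bool (k = i) * a j + of_bool (k = j) * a i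
     - g x $ i $ j * (\<Sum>r\<in>UNIV. matrix_inv (g x) $ k $ r * a r)"

text \<open>The symbol is symmetric in \<open>i\<close> and \<open>j\<close>, so the pair chosen for \<open>\<mu>\<close> does not matter.\<close>

definition conformal_jet :: "(real^'n \<Rightarrow> real^'n^'n) \<Rightarrow> real^'n \<Rightarrow> ('n::finite \<Rightarrow> real) \<Rightarrow> 'n jet" where
  "conformal_jet g x a k \<mu> = (if size \<mu> = 2
     then case SOME p. \<mu> = {#fst p, snd p#} of (i, j) \<Rightarrow> conformal_symbol g x a k i j else 0)"

context
  fixes g :: "real^'n::finite \<Rightarrow> real^'n^'n" and x :: "real^'n"
  assumes g: "det (g x) \<noteq> 0" "transpose (g x) = g x"
begin

lemma conformal_jet_eq: "conformal_jet g x a k {#i, j#} = conformal_symbol g x a k i j"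
proof -
  obtain i' j' where p: "(SOME p. {#i, j#} = {#fst p, snd p#}) = (i', j')"
    by fastforce
  have "{#i, j#} = {#fst (i', j'), snd (i', j')#}"
    unfolding p [symmetric] by (rule someI [of _ "(i, j)"]) simp
  then have "(i' = i \<and> j' = j) \<or> (i' = j \<and> j' = i)"
    by (auto simp: add_eq_conv_ex)
  moreover have "conformal_symbol g x a k j i = conformal_symbol g x a k i j"
    using g by (simp add: conformal_symbol_def metric_sym [of g x j i])
  ultimately show ?thesis
    using p by (auto simp: conformal_jet_def)
qed

lemma conformal_jet_low: "conformal_jet g x a k {#} = 0" "conformal_jet g x a k {#i#} = 0"
  by (simp_all add: conformal_jet_def)

lemma conformal_jet_in_conf2: "conformal_jet g x a \<in> conf2 g x"
proof -
  have "conformal_jet g x a \<in> jets 2"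
    by (simp add: jets_def conformal_jet_def)
  moreover have "killing_eq1 g x (conformal_jet g x a) 0 i j = 0" for i j
    by (simp add: killing_eq1_def conformal_jet_low)
  moreover have "killing_eq2 g x (conformal_jet g x a) (\<chi> r. a r) k i j = 0" for k i j
    by (simp add: killing_eq2_def conformal_jet_low conformal_jet_eq conformal_symbol_def)
  ultimately show ?thesis
    unfolding conf2_def by blast
qed

lemma div_form_conformal_jet: "div_form g x i (conformal_jet g x a) = real CARD('n) * a i"
  using conformal_trace [of g x "\<chi> r. a r" i] g
  by (simp add: div_form_def conformal_jet_low conformal_jet_eq conformal_symbol_def)

end

text \<open>Pull-backs and wedges of jet-valued forms are weighted sums of jets; in this form
  linearity moves the covector through both.\<close>

lemma div_form_sum:
  "div_form g x i (\<lambda>k \<mu>. \<Sum>a\<in>M. c a * \<xi> a k \<mu>) = (\<Sum>a\<in>M. c a * div_form g x i (\<xi> a))"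
proof -
  have "(\<Sum>a\<in>M. c a * div_form g x i (\<xi> a)) = (\<Sum>r\<in>UNIV. \<Sum>a\<in>M.
      c a * (\<xi> a r {#r, i#} + gam g r x * \<xi> a r {#i#} + \<xi> a r {#} * pd r (gam g i) x))"
    unfolding div_form_def sum_distrib_left by (rule sum.swap)
  also have "\<dots> = div_form g x i (\<lambda>k \<mu>. \<Sum>a\<in>M. c a * \<xi> a k \<mu>)"
    unfolding div_form_def
    by (rule sum.cong) (simp_all add: sum.distrib distrib_left sum_distrib_left sum_distrib_right mult_ac)
  finally show ?thesis by simp
qed

lemma div_form_linear:
  "div_form g x i (\<lambda>k \<mu>. a * \<xi> k \<mu> + b * \<eta> k \<mu>) = a * div_form g x i \<xi> + b * div_form g x i \<eta>"
  by (simp add: div_form_def sum.distrib sum_distrib_left algebra_simps)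

lemma div_form_cong:
  "(\<And>k \<mu>. size \<mu> \<le> 2 \<Longrightarrow> \<xi> k \<mu> = \<eta> k \<mu>) \<Longrightarrow> div_form g x i \<xi> = div_form g x i \<eta>"
  by (simp add: div_form_def)

lemma form_fibre_scale: "\<alpha> \<in> form_fibre r \<Longrightarrow> (\<lambda>I. a * \<alpha> I) \<in> form_fibre r"
  by (simp add: form_fibre_def)

lemma wedge_linear:
  "wedge (\<lambda>i I. a * \<phi> i I + b * \<psi> i I) J = a * wedge \<phi> J + b * wedge \<psi> J"
  by (simp add: wedge_def sum.distrib sum_distrib_left algebra_simps)

lemma wedge_scale: "wedge (\<lambda>i I. a * \<phi> i I) J = a * wedge \<phi> J"
  by (simp add: wedge_def sum_distrib_left algebra_simps)

lemma pull_form_scale: "pull_form A (\<lambda>I. a * \<alpha> I) J = a * pull_form A \<alpha> J"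
  by (simp add: pull_form_def sum_distrib_left algebra_simps)

text \<open>The sign turns \<open>dx\<^sup>i \<and> \<alpha>\<close> into \<open>\<alpha> \<and> dx\<^sup>i\<close>.\<close>

definition projection ::
    "(real^'n \<Rightarrow> real^'n^'n) \<Rightarrow> nat \<Rightarrow> real^'n \<Rightarrow> 'n::finite jform \<Rightarrow> 'n list \<Rightarrow> real" where
  "projection g r x Z J = (-1) ^ r * wedge (\<lambda>i I. div_form g x i (Z I)) J"

lemma projection_linear:
  "projection g r x (\<lambda>I k \<mu>. a * Z I k \<mu> + b * W I k \<mu>) J
    = a * projection g r x Z J + b * projection g r x W J"
  by (simp add: projection_def div_form_linear wedge_linear algebra_simps)

lemma projection_in_form_fibre:
  assumes "Z \<in> spencer_fibre g r x"
  shows "projection g r x Z \<in> form_fibre (r + 1)"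
proof -
  have Z: "(\<lambda>I. Z I k \<mu>) \<in> form_fibre r" for k \<mu>
    using assms by (simp add: spencer_fibre_def)
  have "(\<lambda>I. div_form g x i (Z I)) \<in> form_fibre r" for i
    using Z by (simp add: form_fibre_def div_form_def sum_negf [symmetric])
  then have "wedge (\<lambda>i I. div_form g x i (Z I)) \<in> form_fibre (Suc r)"
    by (rule wedge_in_form_fibre)
  from form_fibre_scale [OF this] show ?thesis
    by (simp add: projection_def [abs_def])
qed

text \<open>The pair chosen for \<open>\<mu>\<close> does not depend on \<open>I\<close>, so each
  component is a fixed linear expression in \<open>\<beta> I\<close> and inherits
  skew-symmetry.\<close>

lemma conformal_jet_in_form_fibre:
  assumes "\<And>i. (\<lambda>I. \<beta> I i) \<in> form_fibre r"
  shows "(\<lambda>I. conformal_jet g x (\<beta> I) k \<mu>) \<in> form_fibre r"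
proof -
  have "(\<lambda>I. conformal_symbol g x (\<beta> I) k i j) \<in> form_fibre r" for i j
    using assms by (simp add: form_fibre_def conformal_symbol_def sum_negf)
  then show ?thesis
    by (cases "SOME p. \<mu> = {#fst p, snd p#}") (auto simp: conformal_jet_def form_fibre_def)
qed

lemma projection_surj:
  fixes g :: "real^'n::finite \<Rightarrow> real^'n^'n"
  assumes g: "det (g x) \<noteq> 0" "transpose (g x) = g x" and \<beta>: "\<beta> \<in> form_fibre (r + 1)"
  shows "\<exists>Z\<in>spencer_fibre g r x. projection g r x Z = \<beta>"
proof -
  \<comment> \<open>The constant undoes the sign of the projection, the factor \<open>n\<close> from
    \<open>div_form_conformal_jet\<close> and the factor \<open>r + 1\<close> from
    \<open>wedge_cons\<close>.\<close>
  define c where "c = (-1) ^ r / (real CARD('n) * real (r + 1))"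
  have c: "(-1) ^ r * (real CARD('n) * real (r + 1) * c) = 1"
    by (simp add: c_def power_mult_distrib [symmetric] flip: power_add mult.assoc)
  define \<gamma> where "\<gamma> I = c * \<beta> I" for I
  have \<gamma>: "\<gamma> \<in> form_fibre (Suc r)"
    unfolding \<gamma>_def [abs_def] using form_fibre_scale \<beta> by simp
  \<comment> \<open>The first index of the form becomes the covector index of the jet; the other
    \<open>r\<close> remain form indices.\<close>
  define Z where "Z I = conformal_jet g x (\<lambda>i. \<gamma> (i # I))" for I
  have "Z \<in> spencer_fibre g r x"
    unfolding spencer_fibre_def Z_def
    using conformal_jet_in_form_fibre [of "\<lambda>I i. \<gamma> (i # I)" r] form_fibre_cons [OF \<gamma>]
      conformal_jet_in_conf2 [of g x] g by auto
  moreover have "projection g r x Z J = \<beta> J" for J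
  proof -
    have "projection g r x Z J = (-1) ^ r * (real CARD('n) * wedge (\<lambda>i I. \<gamma> (i # I)) J)"
      using g by (simp add: projection_def Z_def div_form_conformal_jet [of g x] wedge_scale)
    also have "\<dots> = (-1) ^ r * (real CARD('n) * real (r + 1) * c) * \<beta> J"
      unfolding wedge_cons [OF \<gamma>] by (simp add: \<gamma>_def)
    finally show ?thesis
      by (simp only: c mult_1_left)
  qed
  ultimately show ?thesis
    by blast
qed

lemma projection_pull_form:
  fixes T :: "real^'n::finite \<Rightarrow> real^'n"
  assumes S: "open S" and T: "smooth_map_on S T"
    and g: "smooth_matrix_on S g" "\<forall>x\<in>S. det (g x) \<noteq> 0"
    and S': "open S'" "\<forall>x\<in>S. T x \<in> S'"
    and G: "smooth_matrix_on S' G" "\<forall>x\<in>S'. det (G x) \<noteq> 0" "\<forall>x\<in>S'. transpose (G x) = G x"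
    and gG: "\<forall>x\<in>S. g x = transpose (jac T x) ** G (T x) ** jac T x"
    and x: "x \<in> S" and jet: "same_jform 2 S T x Z Z'"
  shows "projection g r x Z = pull_form (jac T x) (projection G r (T x) Z')"
proof
  fix K
  have "div_form g x i (Z I) =
      (\<Sum>m\<in>UNIV. jac T x $ m $ i * pull_form (jac T x) (\<lambda>I'. div_form G (T x) m (Z' I')) I)" for i I
  proof -
    have "div_form g x i (Z I) = (\<Sum>m\<in>UNIV. jac T x $ m $ i *
        div_form G (T x) m (\<lambda>k \<mu>. pull_form (jac T x) (\<lambda>I'. Z' I' k \<mu>) I))"
      by (rule div_form_same_jet [OF S T g S' G gG x]) (use jet in \<open>simp add: same_jform_def\<close>)
    then show ?thesis
      by (simp add: pull_form_def div_form_sum)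
  qed
  then show "projection g r x Z K = pull_form (jac T x) (projection G r (T x) Z') K"
    unfolding projection_def [abs_def] pull_form_scale by (simp add: pull_form_wedge)
qed

lemma smooth_on_div_form:
  assumes S: "open S" and g: "smooth_matrix_on S g" "\<forall>x\<in>S. det (g x) \<noteq> 0"
    and \<xi>: "\<And>k \<mu>. smooth_on S (\<lambda>y. \<xi> y k \<mu>)"
  shows "smooth_on S (\<lambda>y. div_form g y i (\<xi> y))"
  unfolding div_form_def
  by (intro smooth_on_intros [OF S] smooth_on_pd \<xi> smooth_on_gam [OF S g])

lemma smooth_on_projection:
  assumes S: "open S" and g: "smooth_matrix_on S g" "\<forall>x\<in>S. det (g x) \<noteq> 0"
    and X: "\<And>I k \<mu>. smooth_on S (\<lambda>y. X y I k \<mu>)"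
  shows "smooth_on S (\<lambda>y. projection g r y (X y) J)"
  unfolding projection_def wedge_def
  by (intro smooth_on_intros [OF S] smooth_on_div_form [OF S g] X)

text \<open>The second sum collects the derivatives of the coefficients; it completes the formal
  second derivative in \<open>projection_spencer_D\<close>.\<close>

lemma pd_div_form:
  assumes S: "open S" and g: "smooth_matrix_on S g" "\<forall>x\<in>S. det (g x) \<noteq> 0"
    and \<xi>: "\<And>k \<mu>. smooth_on S (\<lambda>y. \<xi> y k \<mu>)" and x: "x \<in> S"
  shows "pd j (\<lambda>y. div_form g y i (\<xi> y)) x = div_form g x i (\<lambda>k \<mu>. pd j (\<lambda>y. \<xi> y k \<mu>) x)
    + (\<Sum>r\<in>UNIV. pd j (gam g r) x * \<xi> x r {#i#} + \<xi> x r {#} * pd j (pd r (gam g i)) x)"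
proof -
  have d: "(\<lambda>y. \<xi> y k \<mu>) differentiable (at x)" "gam g r differentiable (at x)"
    "pd r (gam g i) differentiable (at x)" for k \<mu> r i
    using smooth_on_differentiable [OF \<xi> x] smooth_on_differentiable [OF smooth_on_gam [OF S g] x]
      smooth_on_differentiable [OF smooth_on_pd [OF smooth_on_gam [OF S g]] x] by auto
  show ?thesis
    unfolding div_form_def
    by (simp add: pd_sum pd_add pd_mult d differentiable_add differentiable_mult sum.distrib algebra_simps)
qed

lemma projection_spencer_D:
  assumes S: "open S" and g: "smooth_matrix_on S g" "\<forall>x\<in>S. det (g x) \<noteq> 0"
    and X: "\<And>I k \<mu>. smooth_on S (\<lambda>y. X y I k \<mu>)" and x: "x \<in> S"
    and lift: "\<And>y I k \<mu>. y \<in> S \<Longrightarrow> size \<mu> \<le> 2 \<Longrightarrow> lift3 g y (X y I) k \<mu> = X y I k \<mu>"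
  shows "projection g (r + 1) x (spencer_D g X x) = ext_d (\<lambda>y. projection g r y (X y)) x"
proof
  fix J
  define \<theta> where "\<theta> y i I = div_form g y i (X y I)" for y i I
  define L where "L I = lift3 g x (X x I)" for I
  define \<sigma> where "\<sigma> i j I = pd j (\<lambda>y. \<theta> y i I) x
    - div_form g x i (\<lambda>k \<mu>. pd j (\<lambda>y. X y I k \<mu>) x - L I k (add_mset j \<mu>))" for i j I
  have \<gamma>: "smooth_on S (gam g i)" for i
    using smooth_on_gam [OF S g] .
  have sym: "\<sigma> i j I = \<sigma> j i I" for i j I
  proof -
    have g2: "pd j (pd r (gam g i)) x = pd j (pd i (gam g r)) x" for i j r
      by (rule pd_cong [OF S x]) (rule gam_closed [OF S g])
    \<comment> \<open>This is the formal derivative in directions \<open>i\<close> and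
      \<open>j\<close> of \<open>\<xi>\<^sup>r\<^sub>r + gam g r * \<xi>\<^sup>r\<close>, rewritten
      by closedness of \<open>gam\<close>. The two terms in the inner parentheses are exchanged by
      swapping \<open>i\<close> and \<open>j\<close>; each of the others is symmetric.\<close>
    have \<sigma>: "\<sigma> i j I = (\<Sum>r\<in>UNIV. L I r {#j, r, i#} + gam g r x * L I r {#j, i#}
        + (X x I r {#j#} * pd r (gam g i) x + pd j (gam g r) x * X x I r {#i#})
        + X x I r {#} * pd j (pd i (gam g r)) x)" for i j
    proof -
      have "L I r {#j#} = X x I r {#j#}" for r
        unfolding L_def by (rule lift [OF x]) simp
      then show ?thesis
        unfolding \<sigma>_def \<theta>_def pd_div_form [OF S g X x] unfolding div_form_def
        by (simp add: g2 [of _ _ i] sum.distrib sum_subtractf algebra_simps)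
    qed
    show ?thesis
      unfolding \<sigma>
      by (rule sum.cong) (simp_all add: gam_closed [OF S g x, of j] gam_closed [OF S g x, of i]
          pd_commute [OF S \<gamma> x, of i j] add_mset_commute mult.commute add.commute)
  qed
  \<comment> \<open>Only components of order at most 2 are differentiated, and there the lift agrees
    with \<open>X\<close> throughout the open set \<open>S\<close>.\<close>
  have D: "spencer_D g X x I k \<mu> = wedge (\<lambda>j I. pd j (\<lambda>y. X y I k \<mu>) x - L I k (add_mset j \<mu>)) I"
    if "size \<mu> \<le> 2" for I k \<mu>
  proof -
    have "pd j (\<lambda>y. lift3 g y (X y I) k \<mu>) x = pd j (\<lambda>y. X y I k \<mu>) x" for j I
      by (rule pd_cong [OF S x]) (rule lift [OF _ that])
    then show ?thesis
      using that by (simp add: spencer_D_def spencer_ext_def wedge_def L_def)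
  qed
  have "div_form g x i (spencer_D g X x I)
      = wedge (\<lambda>j I. pd j (\<lambda>y. \<theta> y i I) x - \<sigma> i j I) I" for i I
  proof -
    have "div_form g x i (spencer_D g X x I) = div_form g x i
        (\<lambda>k \<mu>. wedge (\<lambda>j I. pd j (\<lambda>y. X y I k \<mu>) x - L I k (add_mset j \<mu>)) I)"
      by (rule div_form_cong) (rule D)
    then show ?thesis
      by (simp add: wedge_def div_form_sum \<sigma>_def)
  qed
  then have "wedge (\<lambda>i I. div_form g x i (spencer_D g X x I)) J
      = wedge (\<lambda>i. wedge (\<lambda>j I. 1 * pd j (\<lambda>y. \<theta> y i I) x + (-1) * \<sigma> i j I)) J"
    by simp
  also have "\<dots> = wedge (\<lambda>i. wedge (\<lambda>j I. pd j (\<lambda>y. \<theta> y i I) x)) J - wedge (\<lambda>i. wedge (\<sigma> i)) J"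
  proof -
    have "(\<lambda>i. wedge (\<lambda>j I. 1 * pd j (\<lambda>y. \<theta> y i I) x + (-1) * \<sigma> i j I))
        = (\<lambda>i I. 1 * wedge (\<lambda>j I. pd j (\<lambda>y. \<theta> y i I) x) I + (-1) * wedge (\<sigma> i) I)"
      by (intro ext) (rule wedge_linear)
    then have "wedge (\<lambda>i. wedge (\<lambda>j I. 1 * pd j (\<lambda>y. \<theta> y i I) x + (-1) * \<sigma> i j I)) J
        = 1 * wedge (\<lambda>i. wedge (\<lambda>j I. pd j (\<lambda>y. \<theta> y i I) x)) J + (-1) * wedge (\<lambda>i. wedge (\<sigma> i)) J"
      by (simp only: wedge_linear)
    then show ?thesis
      by simp
  qed
  also have "wedge (\<lambda>i. wedge (\<sigma> i)) J = 0"
  proof -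
    have "(\<lambda>j. \<sigma> j i) = \<sigma> i" for i
      by (intro ext sym)
    then show ?thesis
      using wedge_wedge_swap [of \<sigma> J] by simp
  qed
  \<comment> \<open>The differentiation index moves to the front, as in \<open>ext_d\<close>; the
    resulting sign accounts for the passage from \<open>(-1) ^ (r + 1)\<close> to
    \<open>(-1) ^ r\<close>.\<close>
  also have "wedge (\<lambda>i. wedge (\<lambda>j I. pd j (\<lambda>y. \<theta> y i I) x)) J
      = - wedge (\<lambda>j. wedge (\<lambda>i I. pd j (\<lambda>y. \<theta> y i I) x)) J"
    by (rule wedge_wedge_swap)
  finally have "projection g (r + 1) x (spencer_D g X x) J
      = wedge (\<lambda>j I. (-1) ^ r * wedge (\<lambda>i I. pd j (\<lambda>y. \<theta> y i I) x) I) J"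
    by (simp add: projection_def wedge_scale)
  also have "\<dots> = ext_d (\<lambda>y. projection g r y (X y)) x J"
  proof -
    have d: "(\<lambda>y. \<theta> y i I) differentiable (at x)" for i I
      unfolding \<theta>_def by (rule smooth_on_differentiable [OF smooth_on_div_form [OF S g X] x])
    have "pd j (\<lambda>y. projection g r y (X y) I) x = (-1) ^ r * wedge (\<lambda>i I. pd j (\<lambda>y. \<theta> y i I) x) I" for j I
      unfolding projection_def wedge_def \<theta>_def [symmetric]
      by (simp add: pd_cmult pd_sum d differentiable_sum differentiable_mult)
    then show ?thesis
      by (simp add: ext_d_def wedge_def)
  qed
  finally show "projection g (r + 1) x (spencer_D g X x) J = ext_d (\<lambda>y. projection g r y (X y)) x J" .
qed


section \<open>Charts, overlaps and the assembly over the atlas\<close>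

lemma open_overlap:
  assumes "smooth_atlas \<A>" "c \<in> \<A>" "c' \<in> \<A>"
  shows "open (overlap c c')"
proof -
  have c: "open (img c)" "open (fst c')"
      "homeomorphism (fst c) (img c) (snd c) (the_inv_into (fst c) (snd c))"
    using assms by (auto simp: smooth_atlas_def)
  have "openin (top_of_set (fst c)) (fst c \<inter> fst c')"
    using c(2) by (simp add: openin_open_Int)
  then have "openin (top_of_set (img c)) (overlap c c')"
    unfolding overlap_def by (rule homeomorphism_imp_open_map [OF c(3)])
  then show ?thesis
    using openin_open_trans c(1) by blast
qed

lemma trans_map_in_img:
  assumes "smooth_atlas \<A>" "c \<in> \<A>" "x \<in> overlap c c'"
  shows "trans_map c c' x \<in> img c'"
proof -
  obtain p where p: "p \<in> fst c" "p \<in> fst c'" "x = snd c p"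
    using assms(3) by (auto simp: overlap_def)
  have "homeomorphism (fst c) (img c) (snd c) (the_inv_into (fst c) (snd c))"
    using assms by (auto simp: smooth_atlas_def)
  then have "the_inv_into (fst c) (snd c) x = p"
    using p by (auto simp: homeomorphism_def)
  then show ?thesis
    using p by (simp add: trans_map_def img_def)
qed

lemma metric_tensorD:
  assumes "metric_tensor \<A> \<omega>" "c \<in> \<A>"
  shows "smooth_matrix_on (img c) (\<omega> c)" "\<forall>x\<in>img c. det (\<omega> c x) \<noteq> 0"
    "\<forall>x\<in>img c. transpose (\<omega> c x) = \<omega> c x"
  using assms unfolding metric_tensor_def smooth_matrix_on_def by auto

text \<open>A Hilbert choice has its defining property only if a candidate exists; this is the place
  where local solvability enters the Spencer operator.\<close>

lemma lift3_eq:
  assumes "\<exists>\<zeta>. \<zeta> \<in> conf3 g x \<and> (\<forall>k \<mu>. size \<mu> \<le> 2 \<longrightarrow> \<zeta> k \<mu> = \<xi> k \<mu>)" "size \<mu> \<le> 2"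
  shows "lift3 g x \<xi> k \<mu> = \<xi> k \<mu>"
  using someI_ex [OF assms(1)] assms(2) by (simp add: lift3_def)

theorem proposition3p1:
  fixes \<A> :: "('a::{t2_space, second_countable_topology}, 'n::finite) chart set"
    and \<omega> :: "('a, 'n) chart \<Rightarrow> real^'n \<Rightarrow> real^'n^'n"
  assumes "smooth_atlas \<A>" and "CARD('n) \<ge> 3"
    and "metric_tensor \<A> \<omega>" and "conformal_pseudogroup \<A> \<omega>"
  shows "\<exists>\<Phi>. (\<forall>r. bundle_epi \<A> \<omega> r (r + 1) (\<Phi> r)) \<and>
    (\<forall>r. \<forall>X\<in>spencer_sections \<A> \<omega> r. \<forall>c\<in>\<A>. \<forall>x\<in>img c.
       \<Phi> (r + 1) c x (spencer_D (\<omega> c) (X c) x) = ext_d (\<lambda>y. \<Phi> r c y (X c y)) x)"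
proof (intro exI [of _ "\<lambda>r c. projection (\<omega> c) r"] conjI allI ballI)
  have oi: "open (img c)" if "c \<in> \<A>" for c
    using assms(1) that by (auto simp: smooth_atlas_def)
  note met = metric_tensorD [OF assms(3)]
  fix r
  show "bundle_epi \<A> \<omega> r (r + 1) (\<lambda>c. projection (\<omega> c) r)"
    unfolding bundle_epi_def
  proof (intro conjI ballI allI impI)
    fix c x Z W a b J assume c: "c \<in> \<A>" "x \<in> img c"
    show "projection (\<omega> c) r x (\<lambda>I k \<mu>. a * Z I k \<mu> + b * W I k \<mu>) J =
        a * projection (\<omega> c) r x Z J + b * projection (\<omega> c) r x W J"
      by (rule projection_linear)
  next
    fix c x assume c: "c \<in> \<A>" "x \<in> img c"
    show "projection (\<omega> c) r x ` spencer_fibre (\<omega> c) r x = form_fibre (r + 1)"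
    proof
      show "projection (\<omega> c) r x ` spencer_fibre (\<omega> c) r x \<subseteq> form_fibre (r + 1)"
        using projection_in_form_fibre by blast
      show "form_fibre (r + 1) \<subseteq> projection (\<omega> c) r x ` spencer_fibre (\<omega> c) r x"
        using projection_surj [of "\<omega> c" x _ r] met(2,3) [OF c(1)] c(2) by blast
    qed
  next
    fix c c' x Z Z'
    assume c: "c \<in> \<A>" "c' \<in> \<A>" and x: "x \<in> overlap c c'"
      and jet: "same_jform 2 (overlap c c') (trans_map c c') x Z Z'"
    have sub: "overlap c c' \<subseteq> img c"
      by (auto simp: overlap_def img_def)
    have g: "smooth_matrix_on (overlap c c') (\<omega> c)" "\<forall>x\<in>overlap c c'. det (\<omega> c x) \<noteq> 0"
      using met [OF c(1)] sub smooth_on_subset unfolding smooth_matrix_on_def by blast+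
    have T: "smooth_map_on (overlap c c') (trans_map c c')"
      using assms(1) c by (auto simp: smooth_atlas_def)
    have gG: "\<forall>x\<in>overlap c c'. \<omega> c x = transpose (jac (trans_map c c') x) **
        \<omega> c' (trans_map c c' x) ** jac (trans_map c c') x"
      using assms(3) c unfolding metric_tensor_def by blast
    show "projection (\<omega> c) r x Z =
        pull_form (jac (trans_map c c') x) (projection (\<omega> c') r (trans_map c c' x) Z')"
      using projection_pull_form [OF open_overlap [OF assms(1) c] T g oi [OF c(2)] _ met [OF c(2)] gG x jet]
        trans_map_in_img [OF assms(1) c(1)] by blast
  next
    fix c X J assume c: "c \<in> \<A>" and X: "smooth_spencer_in_chart \<omega> r c X"
    show "smooth_on (img c) (\<lambda>x. projection (\<omega> c) r x (X x) J)"
      using X by (intro smooth_on_projection [OF oi [OF c] met(1,2) [OF c]])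
        (auto simp: smooth_spencer_in_chart_def)
  qed
next
  fix r X c x assume X: "X \<in> spencer_sections \<A> \<omega> r" and c: "c \<in> \<A>" and x: "x \<in> img c"
  have oi: "open (img c)"
    using assms(1) c by (auto simp: smooth_atlas_def)
  note met = metric_tensorD [OF assms(3) c]
  have Xc: "smooth_spencer_in_chart \<omega> r c (X c)"
    using X c by (simp add: spencer_sections_def)
  show "projection (\<omega> c) (r + 1) x (spencer_D (\<omega> c) (X c) x) =
      ext_d (\<lambda>y. projection (\<omega> c) r y (X c y)) x"
  proof (rule projection_spencer_D [OF oi met(1,2) _ x])
    show "smooth_on (img c) (\<lambda>y. X c y I k \<mu>)" for I k \<mu>
      using Xc by (simp add: smooth_spencer_in_chart_def)
    fix y I k and \<mu> :: "'n multiset" assume y: "y \<in> img c" and \<mu>: "size \<mu> \<le> 2"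
    have "X c y I \<in> conf2 (\<omega> c) y"
      using Xc y by (simp add: smooth_spencer_in_chart_def spencer_fibre_def)
    \<comment> \<open>A separate local solution is taken for each point \<open>y\<close> and each
      form index \<open>I\<close>; they serve only to show that a lift exists, so no compatibility
      between them is involved.\<close>
    then obtain N v where N: "open N" "y \<in> N" "N \<subseteq> img c" "smooth_map_on N v"
        "is_jet 2 v y (X c y I)" "\<forall>z\<in>N. \<exists>\<eta>\<in>conf2 (\<omega> c) z. is_jet 2 v z \<eta>"
      using assms(4) c y unfolding conformal_pseudogroup_def by meson
    show "lift3 (\<omega> c) y (X c y I) k \<mu> = X c y I k \<mu>"
      using \<mu> by (rule lift3_eq [OF ex_lift_to_conf3 [OF oi met N]])
  qed
qed

end
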